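(* Let $\Phi$ be a point process on $\mathbb{R}^d$ with Radon mean measure $\alpha(\cdot)$, and let $\Phi_1^{pert},\Phi_2^{pert}$ be two perturbations of $\Phi$ with the same translation kernel $\mathcal{X}$ and possibly different replication kernels $\mathcal{N}_1,\mathcal{N}_2$, respectively, both satisfying $$\int_{\mathbb{R}^d}n_j(x)\,\mathcal{X}(x,A-x)\,\alpha(dx)<\infty\quad\text{for all bounded Borel }A\subset\mathbb{R}^d,\qquad n_j(x)=\sum_{k\ge1}k\,\mathcal{N}_j(x,\{k\}),\ j=1,2.$$ If $\mathcal{N}_1(x,\cdot)\le_{cx}\mathcal{N}_2(x,\cdot)$ for $\alpha$-almost all $x\in\mathbb{R}^d$, then $\Phi_1^{pert}\le_{dcx}\Phi_2^{pert}$.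
   Context: A point process on $\mathbb{R}^d$ is a random locally finite counting measure. Let $\mathcal{N}(\cdot,\cdot)$ and $\mathcal{X}(\cdot,\cdot)$ be probability kernels from $\mathbb{R}^d$ to the non-negative integers and to $\mathbb{R}^d$, respectively. The perturbation of $\Phi$ with replication kernel $\mathcal{N}$ and translation kernel $\mathcal{X}$ is the point process $\Phi^{pert}=\bigcup_{X\in\Phi}\bigcup_{i=1}^{N_X}\{X+Y_{iX}\}$ (points counted with multiplicity; inner union empty if $N_X=0$), where, given $\Phi$: the $N_X$, $X\in\Phi$, are independent with $N_X\sim\mathcal{N}(X,\cdot)$; the $\mathbf{Y}_X=(Y_{iX})_{i\ge1}$, $X\in\Phi$, are independent sequences of i.i.d. vectors with $Y_{iX}\sim\mathcal{X}(X,\cdot)$; and all the $N_X$, $\mathbf{Y}_X$ are independent. Distributions on $\mathbb{R}$ satisfy $F\le_{cx}G$ if $\int f\,dF\le\int f\,dG$ for all convex $f:\mathbb{R}\to\mathbb{R}$ for which both integrals are finite. A Lebesgue-measurable $f:\mathbb{R}^k\to\mathbb{R}$ is directionally convex ($dcx$) if for all $x,y,p,q\in\mathbb{R}^k$ with $p\le x\le q$, $p\le y\le q$ (coordinatewise) and $x+y=p+q$ one has $f(x)+f(y)\le f(p)+f(q)$. $\Phi_1\le_{dcx}\Phi_2$ means that for every $k\ge1$ and all bounded Borel $B_1,\dots,B_k\subset\mathbb{R}^d$, $\mathsf{E}f(\Phi_1(B_1),\dots,\Phi_1(B_k))\le\mathsf{E}f(\Phi_2(B_1),\dots,\Phi_2(B_k))$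 for all $dcx$ functions $f$ for which both expectations are finite. *)

theory Defs
  imports "HOL-Probability.Probability"
begin

section \<open>Point processes\<close>

definition locally_finite_counting :: "'a::euclidean_space measure \<Rightarrow> bool" where
  "locally_finite_counting \<mu> \<longleftrightarrow>
     sets \<mu> = sets borel \<and> (\<forall>B\<in>sets borel. bounded B \<longrightarrow> emeasure \<mu> B \<in> \<nat>)"

text \<open>The space of locally finite counting measures with the \<open>\<sigma>\<close>-algebra generated by the
  evaluations \<open>\<mu> \<mapsto> \<mu> B\<close> (same pattern as \<^const>\<open>subprob_algebra\<close>).\<close>

definition counting_measures :: "'a::euclidean_space measure measure" where
  "counting_measures =
     (SUP B \<in> sets borel. vimage_algebra (Collect locally_finite_counting) (\<lambda>\<mu>. emeasure \<mu> B) borel)"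

definition point_process :: "'w measure \<Rightarrow> ('w \<Rightarrow> 'a::euclidean_space measure) \<Rightarrow> bool" where
  "point_process M \<Phi> \<longleftrightarrow> prob_space M \<and> \<Phi> \<in> M \<rightarrow>\<^sub>M counting_measures"

definition mean_measure :: "'w measure \<Rightarrow> ('w \<Rightarrow> 'a::euclidean_space measure) \<Rightarrow> 'a measure" where
  "mean_measure M \<Phi> = measure_of UNIV (sets borel) (\<lambda>B. \<integral>\<^sup>+\<omega>. emeasure (\<Phi> \<omega>) B \<partial>M)"

lemma space_counting_measures: "space counting_measures = Collect locally_finite_counting"
  by (auto simp: counting_measures_def space_Sup_eq_UN)
lemma measurable_emeasure_counting_measures: "B \<in> sets borel \<Longrightarrow> (\<lambda>\<mu>. emeasure \<mu> B) \<in> counting_measures \<rightarrow>\<^sub>M borel"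
  by (auto intro!: measurable_Sup1 measurable_vimage_algebra1 simp: counting_measures_def)
lemma emeasure_mean_measure:
  fixes \<Phi> :: "'w \<Rightarrow> 'a::euclidean_space measure"
  assumes "point_process M \<Phi>" "B \<in> sets borel"
  shows "emeasure (mean_measure M \<Phi>) B = (\<integral>\<^sup>+\<omega>. emeasure (\<Phi> \<omega>) B \<partial>M)"
proof -
  have P: "\<Phi> \<in> M \<rightarrow>\<^sub>M counting_measures" using assms by (simp add: point_process_def)
  have sp: "sets (\<Phi> \<omega>) = sets borel" if "\<omega> \<in> space M" for \<omega>
    using measurable_space[OF P that] by (simp add: space_counting_measures locally_finite_counting_def)
  have ms: "(\<lambda>\<omega>. emeasure (\<Phi> \<omega>) C) \<in> borel_measurable M" if "C \<in> sets borel" for C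
    using measurable_compose[OF P measurable_emeasure_counting_measures[OF that]] .
  show ?thesis
  proof (rule emeasure_measure_of[OF mean_measure_def])
    show "countably_additive (sets (mean_measure M \<Phi>)) (\<lambda>B. \<integral>\<^sup>+\<omega>. emeasure (\<Phi> \<omega>) B \<partial>M)"
      unfolding countably_additive_def mean_measure_def
    proof (intro allI impI)
      fix A :: "nat \<Rightarrow> 'a set"
      assume r: "range A \<subseteq> sets (measure_of UNIV (sets borel) (\<lambda>B. \<integral>\<^sup>+\<omega>. emeasure (\<Phi> \<omega>) B \<partial>M))" and d: "disjoint_family A"
      have r: "A i \<in> sets borel" for i using r sets.sigma_sets_eq[of "borel::'a measure"] by auto
      have "(\<Sum>i. \<integral>\<^sup>+\<omega>. emeasure (\<Phi> \<omega>) (A i) \<partial>M) = (\<integral>\<^sup>+\<omega>. (\<Sum>i. emeasure (\<Phi> \<omega>) (A i)) \<partial>M)"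
        using ms r by (intro nn_integral_suminf[symmetric]) auto
      also have "\<dots> = (\<integral>\<^sup>+\<omega>. emeasure (\<Phi> \<omega>) (\<Union>i. A i) \<partial>M)"
        using r d sp by (intro nn_integral_cong suminf_emeasure) auto
      finally show "(\<Sum>i. \<integral>\<^sup>+\<omega>. emeasure (\<Phi> \<omega>) (A i) \<partial>M) = (\<integral>\<^sup>+\<omega>. emeasure (\<Phi> \<omega>) (\<Union>i. A i) \<partial>M)" .
    qed
    show "B \<in> sets (mean_measure M \<Phi>)" using assms sets.sigma_sets_eq[of "borel::'a measure"]
      by (auto simp: mean_measure_def)
  qed (auto simp: positive_def)
qed

text \<open>On a Euclidean space a Borel measure that is finite on compact sets is automatically
  regular.\<close>

definition radon_measure :: "'a::euclidean_space measure \<Rightarrow> bool" where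
  "radon_measure \<mu> \<longleftrightarrow> sets \<mu> = sets borel \<and> (\<forall>K. compact K \<longrightarrow> emeasure \<mu> K < \<infinity>)"


section \<open>Perturbations\<close>

definition replication_kernel :: "('a::euclidean_space \<Rightarrow> nat measure) \<Rightarrow> bool" where
  "replication_kernel N \<longleftrightarrow> N \<in> borel \<rightarrow>\<^sub>M prob_algebra (count_space UNIV)"

definition translation_kernel :: "('a::euclidean_space \<Rightarrow> 'a measure) \<Rightarrow> bool" where
  "translation_kernel X \<longleftrightarrow> X \<in> borel \<rightarrow>\<^sub>M prob_algebra borel"

definition mean_replication :: "('a \<Rightarrow> nat measure) \<Rightarrow> 'a \<Rightarrow> ennreal" where
  "mean_replication N x = (\<Sum>k. of_nat (Suc k) * emeasure (N x) {Suc k})"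

text \<open>A measurable enumeration of the points of a configuration \<open>\<mu>\<close>, multiple points being listed
  according to their multiplicity.  The points are \<open>\<xi> n \<mu>\<close> for \<open>n < \<mu> UNIV\<close>, the total number of
  points (possibly infinite); the values \<open>\<xi> n \<mu>\<close> for larger \<open>n\<close> are irrelevant.\<close>

definition point_enumeration :: "(nat \<Rightarrow> 'a::euclidean_space measure \<Rightarrow> 'a) \<Rightarrow> bool" where
  "point_enumeration \<xi> \<longleftrightarrow>
     (\<forall>n. \<xi> n \<in> counting_measures \<rightarrow>\<^sub>M borel) \<and>
     (\<forall>\<mu>\<in>space counting_measures. \<forall>B\<in>sets borel.
        emeasure \<mu> B =
          (\<Sum>n. if of_nat n < emeasure \<mu> UNIV then indicator B (\<xi> n \<mu>) else 0))"

text \<open>\<open>\<nu> n\<close> is the number of replicas of the point \<open>\<xi> n (\<Phi> \<omega>)\<close> and \<open>y n i\<close>, \<open>i = 0, 1, \<dots>\<close>, is its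
  sequence of translations.  The conditional law given \<open>\<Phi>\<close> is specified on all finite-dimensional
  cylinder sets, and only for the first \<open>m\<close> points on the event that \<open>\<Phi>\<close> has at least \<open>m\<close> points, so
  that marks with indices beyond the number of points are unrestricted.\<close>

definition perturbation_marks ::
  "'w measure \<Rightarrow> ('w \<Rightarrow> 'a::euclidean_space measure) \<Rightarrow> ('a \<Rightarrow> nat measure) \<Rightarrow> ('a \<Rightarrow> 'a measure) \<Rightarrow>
     (nat \<Rightarrow> 'a measure \<Rightarrow> 'a) \<Rightarrow> (nat \<Rightarrow> 'w \<Rightarrow> nat) \<Rightarrow> (nat \<Rightarrow> nat \<Rightarrow> 'w \<Rightarrow> 'a) \<Rightarrow> bool" where
  "perturbation_marks M \<Phi> N X \<xi> \<nu> y \<longleftrightarrow>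
     (\<forall>n. \<nu> n \<in> M \<rightarrow>\<^sub>M count_space UNIV) \<and>
     (\<forall>n i. y n i \<in> M \<rightarrow>\<^sub>M borel) \<and>
     (\<forall>m l D A. (\<forall>n i. A n i \<in> sets borel) \<longrightarrow>
        (AE \<omega> in M. of_nat m \<le> emeasure (\<Phi> \<omega>) UNIV \<longrightarrow>
           real_cond_exp M (vimage_algebra (space M) \<Phi> counting_measures)
             (indicator {\<omega>\<in>space M. \<forall>n<m. \<nu> n \<omega> \<in> D n \<and> (\<forall>i<l. y n i \<omega> \<in> A n i)}) \<omega> =
           (\<Prod>n<m. measure (N (\<xi> n (\<Phi> \<omega>))) (D n) *
                     (\<Prod>i<l. measure (X (\<xi> n (\<Phi> \<omega>))) (A n i)))))"

text \<open>The defining identity is required almost surely only, because the superposition may fail to be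
  locally finite on a null event.\<close>

definition perturbation ::
  "'w measure \<Rightarrow> ('w \<Rightarrow> 'a::euclidean_space measure) \<Rightarrow> ('a \<Rightarrow> nat measure) \<Rightarrow> ('a \<Rightarrow> 'a measure) \<Rightarrow>
     ('w \<Rightarrow> 'a measure) \<Rightarrow> bool" where
  "perturbation M \<Phi> N X \<Psi> \<longleftrightarrow>
     point_process M \<Psi> \<and>
     (\<exists>\<xi> \<nu> y. point_enumeration \<xi> \<and> perturbation_marks M \<Phi> N X \<xi> \<nu> y \<and>
        (AE \<omega> in M. \<forall>B\<in>sets borel.
           emeasure (\<Psi> \<omega>) B =
             (\<Sum>n. if of_nat n < emeasure (\<Phi> \<omega>) UNIV
                   then \<Sum>i<\<nu> n \<omega>. indicator B (\<xi> n (\<Phi> \<omega>) + y n i \<omega>) else 0)))"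


section \<open>Convex and directionally convex orders\<close>

definition cx_le :: "real measure \<Rightarrow> real measure \<Rightarrow> bool" where
  "cx_le F G \<longleftrightarrow>
     (\<forall>f. convex_on UNIV f \<and> integrable F f \<and> integrable G f \<longrightarrow>
        integral\<^sup>L F f \<le> integral\<^sup>L G f)"

text \<open>Vectors in \<open>\<real>\<^sup>k\<close> are extensional functions on \<open>{..<k}\<close>, since \<open>k\<close> is quantified inside the
  definition of the \<open>dcx\<close> order.\<close>

definition dcx :: "nat \<Rightarrow> ((nat \<Rightarrow> real) \<Rightarrow> real) \<Rightarrow> bool" where
  "dcx k f \<longleftrightarrow>
     f \<in> borel_measurable (completion (Pi\<^sub>M {..<k} (\<lambda>_. lborel))) \<and>
     (\<forall>x\<in>{..<k} \<rightarrow>\<^sub>E UNIV. \<forall>y\<in>{..<k} \<rightarrow>\<^sub>E UNIV. \<forall>p\<in>{..<k} \<rightarrow>\<^sub>E UNIV. \<forall>q\<in>{..<k} \<rightarrow>\<^sub>E UNIV.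
        (\<forall>i<k. p i \<le> x i \<and> x i \<le> q i \<and> p i \<le> y i \<and> y i \<le> q i \<and> x i + y i = p i + q i) \<longrightarrow>
        f x + f y \<le> f p + f q)"

definition count_vector ::
  "nat \<Rightarrow> (nat \<Rightarrow> 'a set) \<Rightarrow> 'a measure \<Rightarrow> nat \<Rightarrow> real" where
  "count_vector k B \<mu> = (\<lambda>i\<in>{..<k}. measure \<mu> (B i))"

definition dcx_le ::
  "'v measure \<Rightarrow> ('v \<Rightarrow> 'a::euclidean_space measure) \<Rightarrow>
   'w measure \<Rightarrow> ('w \<Rightarrow> 'a measure) \<Rightarrow> bool" where
  "dcx_le M\<^sub>1 \<Phi>\<^sub>1 M\<^sub>2 \<Phi>\<^sub>2 \<longleftrightarrow>
     (\<forall>k\<ge>1. \<forall>B. (\<forall>i<k. B i \<in> sets borel \<and> bounded (B i)) \<longrightarrow>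
        (\<forall>f. dcx k f \<and>
             integrable M\<^sub>1 (\<lambda>\<omega>. f (count_vector k B (\<Phi>\<^sub>1 \<omega>))) \<and>
             integrable M\<^sub>2 (\<lambda>\<omega>. f (count_vector k B (\<Phi>\<^sub>2 \<omega>))) \<longrightarrow>
             (\<integral>\<omega>. f (count_vector k B (\<Phi>\<^sub>1 \<omega>)) \<partial>M\<^sub>1) \<le> (\<integral>\<omega>. f (count_vector k B (\<Phi>\<^sub>2 \<omega>)) \<partial>M\<^sub>2)))"

end

(*
Only the values of f on the lattice N^k matter.  There a dcx function is an affine function plus a
nonnegative, nondecreasing dcx remainder h, and the affine part has the same finite expectation under
both perturbations, because convex order forces equal means.  So it suffices to compare E h, and since
h is nonnegative and monotone this can be done for finitely many points of the process at a time,
followed by monotone convergence.  Given the process, the points contribute independently.  For one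
point, the expectation of h as a function of the number d of replicas is nondecreasing and convex,
hence a nonnegative mixture of the functions (d - j)^+, and it grows when the law of d grows in convex
order.  The points are exchanged one after the other; the remaining ones are integrated out, which
preserves monotonicity and directional convexity.
*)
theory Submission
  imports Defs
begin

section \<open>Directional convexity and superposition of discrete marks\<close>

text \<open>The counts depend on a replica only through the pattern of sets \<open>B r\<close>
  containing it. Recording this pattern, the type of the replica, turns the marks of a point into a
  list over a countable set. Its conditional law is then a \<open>pmf\<close> depending measurably
  on the point, and conditioning becomes countable summation. Three obstacles shape the rest. The
  law of the marks is prescribed on cylinder sets of the translations alone, and only for points
  that exist, whereas a type depends jointly on a point and its translation; so the law has to be
  extended, on events determined by \<open>\<Phi>\<close> that guarantee enough points. The two
  perturbations may list the points in different orders and there may be infinitely many points, so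
  truncated lists are compared as multisets. Convex order says nothing about functions that are not
  integrable, so replication means must be shown finite at almost every point before they can be
  compared; this comes from the integrability hypothesis on growing balls.\<close>

definition list_pmf :: "nat pmf \<Rightarrow> 'b pmf \<Rightarrow> 'b list pmf" where
  "list_pmf p t = bind_pmf p (\<lambda>d. replicate_pmf d t)"

primrec product_list_pmf :: "'c pmf list \<Rightarrow> 'c list pmf" where
  "product_list_pmf [] = return_pmf []"
| "product_list_pmf (p # ps) = bind_pmf p (\<lambda>x. map_pmf ((#) x) (product_list_pmf ps))"

text \<open>Order is forgotten only at this last stage: the probability of a list is a plain product
  over its positions, while that of a multiset would carry multinomial coefficients.\<close>

definition superposition_pmf :: "'b list pmf list \<Rightarrow> 'b multiset pmf" where
  "superposition_pmf qs = map_pmf (\<lambda>ls. mset (concat ls)) (product_list_pmf qs)"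

text \<open>The discrete form of increasing and directionally convex, with \<open>A\<close>,
  \<open>A + B\<close>, \<open>A + C\<close>, \<open>A + B + C\<close> as the corners p, x, y, q.
  The increments \<open>B\<close> and \<open>C\<close> may overlap; \<open>B = C\<close> gives
  convexity in a repeated increment. Values lie in \<open>ennreal\<close> so that every average
  exists.\<close>

definition msupermodular :: "('b multiset \<Rightarrow> ennreal) \<Rightarrow> bool" where
  "msupermodular H \<longleftrightarrow> (\<forall>A B. H A \<le> H (A + B)) \<and>
     (\<forall>A B C. H (A + B) + H (A + C) \<le> H A + H (A + B + C))"

lemma pmf_replicate_pmf:
  "pmf (replicate_pmf n t) ws = (if length ws = n then prod_list (map (pmf t) ws) else 0)"
proof (induction n arbitrary: ws)
  case 0
  show ?case by (cases ws) auto
next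
  case (Suc n)
  have *: "replicate_pmf (Suc n) t = map_pmf (\<lambda>(x, xs). x # xs) (pair_pmf t (replicate_pmf n t))"
    by (simp add: map_pmf_def pair_pmf_def bind_assoc_pmf bind_return_pmf)
  show ?case
  proof (cases ws)
    case Nil
    then have "ws \<notin> set_pmf (replicate_pmf (Suc n) t)" unfolding * by auto
    then show ?thesis using Nil by (simp add: set_pmf_iff del: replicate_pmf.simps product_list_pmf.simps)
  next
    case (Cons x xs)
    have "pmf (map_pmf (\<lambda>(x, xs). x # xs) (pair_pmf t (replicate_pmf n t))) ((\<lambda>(x, xs). x # xs) (x, xs))
        = pmf (pair_pmf t (replicate_pmf n t)) (x, xs)"
      by (rule pmf_map_inj') (auto simp: inj_on_def)
    then show ?thesis unfolding * using Cons Suc by (simp add: pmf_pair)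
  qed
qed

lemma pmf_list_pmf: "pmf (list_pmf p t) ws = pmf p (length ws) * prod_list (map (pmf t) ws)"
proof -
  let ?c = "prod_list (map (pmf t) ws)"
  have c: "0 \<le> ?c" by (rule prod_list_nonneg) auto
  have "ennreal (pmf (list_pmf p t) ws) = (\<integral>\<^sup>+d. ennreal ?c * indicator {length ws} d \<partial>p)"
    unfolding list_pmf_def ennreal_pmf_bind pmf_replicate_pmf
    by (intro nn_integral_cong) (auto split: split_indicator)
  also have "\<dots> = ennreal ?c * ennreal (pmf p (length ws))"
    by (subst nn_integral_cmult_indicator) (simp_all add: emeasure_pmf_single)
  also have "\<dots> = ennreal (pmf p (length ws) * ?c)"
    using c by (simp add: ennreal_mult mult.commute)
  finally show ?thesis
    using c by simp
qed

lemma pmf_product_list_pmf: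
  "pmf (product_list_pmf ps) ls =
     (if length ls = length ps then \<Prod>i<length ps. pmf (ps ! i) (ls ! i) else 0)"
proof (induction ps arbitrary: ls)
  case Nil
  show ?case by (cases ls) auto
next
  case (Cons p ps)
  have *: "product_list_pmf (p # ps) = map_pmf (\<lambda>(x, xs). x # xs) (pair_pmf p (product_list_pmf ps))"
    by (simp add: map_pmf_def pair_pmf_def bind_assoc_pmf bind_return_pmf)
  show ?case
  proof (cases ls)
    case Nil
    then have "ls \<notin> set_pmf (product_list_pmf (p # ps))" unfolding * by auto
    then show ?thesis using Nil by (simp add: set_pmf_iff del: replicate_pmf.simps product_list_pmf.simps)
  next
    case (Cons x xs)
    have "pmf (map_pmf (\<lambda>(x, xs). x # xs) (pair_pmf p (product_list_pmf ps))) ((\<lambda>(x, xs). x # xs) (x, xs))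
        = pmf (pair_pmf p (product_list_pmf ps)) (x, xs)"
      by (rule pmf_map_inj') (auto simp: inj_on_def)
    then show ?thesis unfolding * using Cons Cons.IH
      by (simp add: pmf_pair prod.lessThan_Suc_shift del: prod.lessThan_Suc)
  qed
qed

lemma superposition_pmf_Nil [simp]: "superposition_pmf [] = return_pmf {#}"
  by (simp add: superposition_pmf_def)

lemma superposition_pmf_Cons:
  "superposition_pmf (q # qs) = bind_pmf q (\<lambda>ws. map_pmf (\<lambda>A. mset ws + A) (superposition_pmf qs))"
  by (simp add: superposition_pmf_def map_bind_pmf map_pmf_comp)

lemma superposition_pmf_fold:
  "superposition_pmf qs =
    List.fold (\<lambda>q r. bind_pmf q (\<lambda>ws. map_pmf (\<lambda>A. mset ws + A) r)) (rev qs) (return_pmf {#})"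
  by (induction qs) (simp_all add: superposition_pmf_Cons)

text \<open>Adding the contribution of one point is an operation on laws, and two such operations
  commute because multiset addition does. This makes the order in which points are enumerated
  irrelevant.\<close>

lemma superposition_pmf_mset_cong:
  assumes "mset qs = mset rs"
  shows "superposition_pmf qs = superposition_pmf rs"
  unfolding superposition_pmf_fold
proof (rule fun_cong[where f = "List.fold _ _"], rule fold_multiset_equiv)
  show "mset (rev qs) = mset (rev rs)" using assms by simp
  fix p q :: "'a list pmf"
  show "(\<lambda>r. bind_pmf p (\<lambda>ws. map_pmf (\<lambda>A. mset ws + A) r)) \<circ> (\<lambda>r. bind_pmf q (\<lambda>ws. map_pmf (\<lambda>A. mset ws + A) r))
      = (\<lambda>r. bind_pmf q (\<lambda>ws. map_pmf (\<lambda>A. mset ws + A) r)) \<circ> (\<lambda>r. bind_pmf p (\<lambda>ws. map_pmf (\<lambda>A. mset ws + A) r))"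
    by (rule ext)
      (simp add: map_bind_pmf map_pmf_comp bind_commute_pmf[of p] add.left_commute)
qed

text \<open>The surplus points can be moved to the front of the list, where each of them merely adds
  a random multiset to the configuration.\<close>

lemma superposition_pmf_mono_mset:
  assumes mono: "\<And>A B. H A \<le> H (A + B)" and sub: "mset qs \<subseteq># mset rs"
  shows "(\<integral>\<^sup>+A. H A \<partial>superposition_pmf qs) \<le> (\<integral>\<^sup>+A. H A \<partial>superposition_pmf rs)"
proof -
  obtain zs where zs: "mset rs = mset (zs @ qs)"
  proof -
    obtain zs where "mset zs = mset rs - mset qs" using ex_mset by blast
    then show ?thesis using sub by (intro that[of zs]) simp
  qed
  have "(\<integral>\<^sup>+A. H A \<partial>superposition_pmf qs) \<le> (\<integral>\<^sup>+A. H A \<partial>superposition_pmf (zs @ qs))"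
  proof (induction zs)
    case (Cons z zs)
    have "(\<integral>\<^sup>+A. H A \<partial>superposition_pmf qs) \<le> (\<integral>\<^sup>+A. H A \<partial>superposition_pmf (zs @ qs))"
      by (rule Cons)
    also have "\<dots> = (\<integral>\<^sup>+ws. (\<integral>\<^sup>+A. H A \<partial>superposition_pmf (zs @ qs)) \<partial>z)"
      by simp
    also have "\<dots> \<le> (\<integral>\<^sup>+ws. (\<integral>\<^sup>+A. H (mset ws + A) \<partial>superposition_pmf (zs @ qs)) \<partial>z)"
      by (intro nn_integral_mono) (metis add.commute mono)
    finally show ?case by (simp add: superposition_pmf_Cons)
  qed simp
  then show ?thesis using superposition_pmf_mset_cong[OF zs] by simp
qed

text \<open>Here the subtraction \<open>d - j\<close> is truncated, so that it is the convex function \<open>(d - j)\<^sup>+\<close>.\<close>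

lemma convex_nat_expansion:
  fixes g :: "nat \<Rightarrow> ennreal"
  assumes mono: "\<And>d. g d \<le> g (Suc d)"
    and cvx: "\<And>d. 2 * g (Suc d) \<le> g d + g (Suc (Suc d))"
  obtains a where "\<And>d. g d = g 0 + (\<Sum>j. a j * of_nat (d - j))"
proof -
  define s where "s j = g (Suc j) - g j" for j
  \<comment> \<open>Second differences of \<open>g\<close>, with the first increment placed at index
    0. Summation by parts, twice, recovers \<open>g\<close> from them as a combination of the
    functions \<open>d - j\<close>.\<close>
  define a where "a j = (case j of 0 \<Rightarrow> s 0 | Suc i \<Rightarrow> s (Suc i) - s i)" for j
  \<comment> \<open>Infinite values do no harm: in \<open>ennreal\<close>,
    \<open>\<top> - c = \<top>\<close> for every \<open>c\<close>, so the increments are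
    \<open>\<top>\<close> from the first step that reaches \<open>\<top>\<close> on.\<close>
  have smono: "s j \<le> s (Suc j)" for j
  proof (cases "g (Suc j) = \<top>")
    case True
    then show ?thesis using mono[of "Suc j"] by (simp add: s_def top_unique)
  next
    case fin: False
    then have fin0: "g j \<noteq> \<top>" using mono[of j] by (auto simp: top_unique)
    show ?thesis
    proof (cases "g (Suc (Suc j)) = \<top>")
      case True
      then show ?thesis by (simp add: s_def)
    next
      case False
      then obtain x y z where "x \<ge> 0" "y \<ge> 0" "z \<ge> 0" "g j = ennreal x" "g (Suc j) = ennreal y" "g (Suc (Suc j)) = ennreal z"
        using fin fin0 by (metis ennreal_cases)
      moreover have "2 * ennreal y = ennreal (2 * y)" using \<open>y \<ge> 0\<close> by (simp add: ennreal_mult)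
      ultimately show ?thesis using cvx[of j]
        by (auto simp: s_def ennreal_minus simp flip: ennreal_plus intro!: ennreal_leI)
    qed
  qed
  have tele: "(\<Sum>j<Suc d. a j) = s d" for d
  proof (induction d)
    case (Suc d)
    then show ?case using smono[of d] by (simp add: a_def add_diff_inverse_ennreal)
  qed (simp add: a_def)
  have fin: "(\<Sum>j. a j * of_nat (d - j)) = (\<Sum>j<d. a j * of_nat (d - j))" for d
    by (rule suminf_finite) auto
  have "g d = g 0 + (\<Sum>j<d. a j * of_nat (d - j))" for d
  proof (induction d)
    case (Suc d)
    have "g (Suc d) = g d + s d" using mono[of d] by (simp add: s_def add_diff_inverse_ennreal)
    also have "\<dots> = g 0 + ((\<Sum>j<Suc d. a j * of_nat (d - j)) + (\<Sum>j<Suc d. a j))"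
      using Suc tele[of d] by (simp add: add.assoc)
    also have "\<dots> = g 0 + (\<Sum>j<Suc d. a j * of_nat (Suc d - j))"
      by (subst sum.distrib[symmetric]) (auto intro!: sum.cong simp: Suc_diff_le distrib_left add.commute)
    finally show ?case .
  qed simp
  then show ?thesis using that fin by metis
qed

text \<open>The expansion has weights in \<open>ennreal\<close>, so sum and integral may be
  exchanged without any integrability, and the constant \<open>g 0\<close> is the same for both laws
  because each has mass one.\<close>

lemma nn_integral_convex_nat_mono:
  fixes g :: "nat \<Rightarrow> ennreal" and p q :: "nat pmf"
  assumes mono: "\<And>d. g d \<le> g (Suc d)"
    and cvx: "\<And>d. 2 * g (Suc d) \<le> g d + g (Suc (Suc d))"
    and le: "\<And>j. (\<integral>\<^sup>+d. of_nat (d - j) \<partial>p) \<le> (\<integral>\<^sup>+d. of_nat (d - j) \<partial>q)"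
  shows "(\<integral>\<^sup>+d. g d \<partial>p) \<le> (\<integral>\<^sup>+d. g d \<partial>q)"
proof -
  obtain a where a: "\<And>d. g d = g 0 + (\<Sum>j. a j * of_nat (d - j))"
    using convex_nat_expansion[of g] mono cvx by metis
  have *: "(\<integral>\<^sup>+d. g d \<partial>r) = g 0 + (\<Sum>j. a j * (\<integral>\<^sup>+d. of_nat (d - j) \<partial>r))" for r :: "nat pmf"
    by (subst a) (simp add: nn_integral_add nn_integral_suminf nn_integral_cmult)
  show ?thesis unfolding *
    by (intro add_left_mono suminf_le mult_left_mono le) auto
qed

lemma msupermodular_shift:
  assumes "msupermodular H" shows "msupermodular (\<lambda>A. H (Z + A))"
  unfolding msupermodular_def
proof (intro conjI allI)
  fix A B C
  show "H (Z + A) \<le> H (Z + (A + B))"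
    using assms unfolding msupermodular_def by (simp add: add.assoc[symmetric])
  show "H (Z + (A + B)) + H (Z + (A + C)) \<le> H (Z + A) + H (Z + (A + B + C))"
    using assms unfolding msupermodular_def by (simp add: add.assoc[symmetric])
qed

text \<open>Both defining inequalities are linear in \<open>H\<close>, hence survive averaging.
  Together with the shift this allows the contribution of the other points to be integrated
  out.\<close>

lemma msupermodular_integral:
  assumes "\<And>Z. msupermodular (\<lambda>A. H Z A)" shows "msupermodular (\<lambda>A. \<integral>\<^sup>+Z. H Z A \<partial>measure_pmf r)"
  using assms unfolding msupermodular_def
  by (auto intro!: nn_integral_mono simp: nn_integral_add[symmetric])

text \<open>Convexity in the number of replicas comes from a coupling: let A consist of d replicas
  and let x, y be two further independent ones. Both A + x and A + y have the law of d + 1 replicas,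
  and A + x + y that of d + 2, so supermodularity of \<open>H\<close> at A, averaged, is exactly the
  second difference inequality.\<close>

lemma nn_integral_list_pmf_mono:
  fixes p q :: "nat pmf" and t :: "'b pmf"
  assumes H: "msupermodular H"
    and le: "\<And>j. (\<integral>\<^sup>+d. of_nat (d - j) \<partial>p) \<le> (\<integral>\<^sup>+d. of_nat (d - j) \<partial>q)"
  shows "(\<integral>\<^sup>+ws. H (mset ws) \<partial>list_pmf p t) \<le> (\<integral>\<^sup>+ws. H (mset ws) \<partial>list_pmf q t)"
proof -
  define g where "g d = (\<integral>\<^sup>+ws. H (mset ws) \<partial>replicate_pmf d t)" for d
  have g1: "g (Suc d) = (\<integral>\<^sup>+ws. \<integral>\<^sup>+x. H (mset ws + {#x#}) \<partial>t \<partial>replicate_pmf d t)" for d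
  proof -
    have "replicate_pmf (Suc d) t = bind_pmf (replicate_pmf d t) (\<lambda>ws. bind_pmf t (\<lambda>x. return_pmf (x # ws)))"
      by (simp add: bind_commute_pmf[of t])
    then show ?thesis unfolding g_def by (simp only: nn_integral_bind_pmf) simp
  qed
  have g2: "g (Suc (Suc d)) = (\<integral>\<^sup>+ws. \<integral>\<^sup>+x. \<integral>\<^sup>+y. H (mset ws + {#x#} + {#y#}) \<partial>t \<partial>t \<partial>replicate_pmf d t)" for d
  proof -
    have "g (Suc (Suc d)) = (\<integral>\<^sup>+x. (\<integral>\<^sup>+y. \<integral>\<^sup>+ws. H (mset ws + {#x#} + {#y#}) \<partial>replicate_pmf d t \<partial>t) \<partial>t)"
      by (simp add: g_def add_mset_commute)
    \<comment> \<open>The iterated integral is rewritten as the mean of a law on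
      \<open>ennreal\<close>, so that exchanging the integrals becomes commutation of
      \<open>bind_pmf\<close>.\<close>
    also have "\<dots> = (\<integral>\<^sup>+A. A \<partial>bind_pmf t (\<lambda>x. bind_pmf t (\<lambda>y. bind_pmf (replicate_pmf d t)
          (\<lambda>ws. return_pmf (H (mset ws + {#x#} + {#y#}))))))"
      by simp
    also have "\<dots> = (\<integral>\<^sup>+A. A \<partial>bind_pmf (replicate_pmf d t) (\<lambda>ws. bind_pmf t (\<lambda>x. bind_pmf t
          (\<lambda>y. return_pmf (H (mset ws + {#x#} + {#y#}))))))"
      by (subst (2) bind_commute_pmf, subst bind_commute_pmf) (rule refl)
    finally show ?thesis by simp
  qed
  have mono: "g d \<le> g (Suc d)" for d
  proof -
    have "g d = (\<integral>\<^sup>+ws. \<integral>\<^sup>+x. H (mset ws) \<partial>t \<partial>replicate_pmf d t)" by (simp add: g_def)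
    also have "\<dots> \<le> g (Suc d)" unfolding g1
      using H unfolding msupermodular_def by (intro nn_integral_mono) blast
    finally show ?thesis .
  qed
  have cvx: "2 * g (Suc d) \<le> g d + g (Suc (Suc d))" for d
  proof -
    have "2 * g (Suc d) = (\<integral>\<^sup>+ws. \<integral>\<^sup>+x. \<integral>\<^sup>+y. H (mset ws + {#x#}) + H (mset ws + {#y#}) \<partial>t \<partial>t \<partial>replicate_pmf d t)"
      unfolding g1 by (simp add: nn_integral_add mult_2)
    also have "\<dots> \<le> (\<integral>\<^sup>+ws. \<integral>\<^sup>+x. \<integral>\<^sup>+y. H (mset ws) + H (mset ws + {#x#} + {#y#}) \<partial>t \<partial>t \<partial>replicate_pmf d t)"
      using H unfolding msupermodular_def by (intro nn_integral_mono) blast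
    also have "\<dots> = g d + g (Suc (Suc d))"
      unfolding g2 by (simp add: nn_integral_add g_def)
    finally show ?thesis .
  qed
  show ?thesis unfolding list_pmf_def nn_integral_bind_pmf
    using nn_integral_convex_nat_mono[of g p q, OF mono cvx le] unfolding g_def .
qed

text \<open>The induction runs over arbitrary \<open>H\<close>: fixing the list of the first point
  replaces \<open>H\<close> by a shift, for which the tail is exchanged. The first point then faces
  the average of these shifts over the new tail.\<close>

lemma superposition_pmf_mono:
  fixes p q :: "'a \<Rightarrow> nat pmf" and t :: "'a \<Rightarrow> 'b pmf"
  assumes "msupermodular H"
    and "\<And>x j. x \<in> set xs \<Longrightarrow> (\<integral>\<^sup>+d. of_nat (d - j) \<partial>p x) \<le> (\<integral>\<^sup>+d. of_nat (d - j) \<partial>q x)"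
  shows "(\<integral>\<^sup>+A. H A \<partial>superposition_pmf (map (\<lambda>x. list_pmf (p x) (t x)) xs))
      \<le> (\<integral>\<^sup>+A. H A \<partial>superposition_pmf (map (\<lambda>x. list_pmf (q x) (t x)) xs))"
  using assms
proof (induction xs arbitrary: H)
  case (Cons x xs)
  let ?p = "superposition_pmf (map (\<lambda>x. list_pmf (p x) (t x)) xs)"
  let ?q = "superposition_pmf (map (\<lambda>x. list_pmf (q x) (t x)) xs)"
  have "(\<integral>\<^sup>+A. H A \<partial>superposition_pmf (map (\<lambda>x. list_pmf (p x) (t x)) (x # xs)))
     = (\<integral>\<^sup>+ws. \<integral>\<^sup>+A. H (mset ws + A) \<partial>?p \<partial>list_pmf (p x) (t x))"
    by (simp add: superposition_pmf_Cons)
  also have "\<dots> \<le> (\<integral>\<^sup>+ws. \<integral>\<^sup>+A. H (mset ws + A) \<partial>?q \<partial>list_pmf (p x) (t x))"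
    using Cons.prems by (intro nn_integral_mono Cons.IH msupermodular_shift) auto
  also have "\<dots> \<le> (\<integral>\<^sup>+ws. \<integral>\<^sup>+A. H (mset ws + A) \<partial>?q \<partial>list_pmf (q x) (t x))"
    using Cons.prems msupermodular_shift[of H]
    by (intro nn_integral_list_pmf_mono[where H = "\<lambda>B. \<integral>\<^sup>+A. H (B + A) \<partial>?q"] msupermodular_integral)
       (auto simp: add.commute)
  finally show ?case by (simp add: superposition_pmf_Cons)
qed simp

text \<open>Wald's identity, summed over the points. The assumption \<open>zero\<close> excludes the
  value \<open>\<top>\<close> at the empty multiset, which additivity alone would permit.\<close>

lemma superposition_pmf_additive:
  fixes H :: "'b multiset \<Rightarrow> ennreal" and p :: "'a \<Rightarrow> nat pmf" and t :: "'a \<Rightarrow> 'b pmf"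
  assumes add: "\<And>A B. H (A + B) = H A + H B" and zero: "H {#} = 0"
  shows "(\<integral>\<^sup>+A. H A \<partial>superposition_pmf (map (\<lambda>x. list_pmf (p x) (t x)) xs))
      = (\<Sum>x\<leftarrow>xs. (\<integral>\<^sup>+d. of_nat d \<partial>p x) * (\<integral>\<^sup>+b. H {#b#} \<partial>t x))"
proof (induction xs)
  case (Cons x xs)
  have rep: "(\<integral>\<^sup>+ws. H (mset ws) \<partial>replicate_pmf d (t x)) = of_nat d * (\<integral>\<^sup>+b. H {#b#} \<partial>t x)" for d
  proof (induction d)
    case (Suc d)
    have "(\<integral>\<^sup>+ws. H (mset ws) \<partial>replicate_pmf (Suc d) (t x))
        = (\<integral>\<^sup>+y. \<integral>\<^sup>+ws. H ({#y#} + mset ws) \<partial>replicate_pmf d (t x) \<partial>t x)"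
      by simp
    also have "\<dots> = (\<integral>\<^sup>+b. H {#b#} \<partial>t x) + of_nat d * (\<integral>\<^sup>+b. H {#b#} \<partial>t x)"
      unfolding add by (simp add: nn_integral_add Suc)
    finally show ?case by (simp add: distrib_right)
  qed (simp add: zero)
  have "(\<integral>\<^sup>+A. H A \<partial>superposition_pmf (map (\<lambda>x. list_pmf (p x) (t x)) (x # xs)))
     = (\<integral>\<^sup>+ws. H (mset ws) \<partial>list_pmf (p x) (t x)) + (\<integral>\<^sup>+A. H A \<partial>superposition_pmf (map (\<lambda>x. list_pmf (p x) (t x)) xs))"
    by (simp add: superposition_pmf_Cons add nn_integral_add)
  also have "(\<integral>\<^sup>+ws. H (mset ws) \<partial>list_pmf (p x) (t x)) = (\<integral>\<^sup>+d. of_nat d \<partial>p x) * (\<integral>\<^sup>+b. H {#b#} \<partial>t x)"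
    by (simp add: list_pmf_def rep nn_integral_multc)
  finally show ?case using Cons by simp
qed (simp add: zero)

section \<open>Conditional laws of marked points\<close>

text \<open>The bridge from kernels, which are measures, to the discrete calculus above. For a
  probability measure on a countable type with all subsets measurable, nothing is lost.\<close>

definition pmf_of_measure :: "'b measure \<Rightarrow> 'b pmf" where
  "pmf_of_measure K = embed_pmf (\<lambda>b. measure K {b})"

lemma measure_pmf_of_measure:
  fixes K :: "'b::countable measure"
  assumes "prob_space K" and [measurable_cong]: "sets K = sets (count_space UNIV)"
  shows "measure_pmf (pmf_of_measure K) = K"
proof -
  interpret prob_space K by fact
  have "space K = UNIV" using sets_eq_imp_space_eq[OF assms(2)] by simp
  then have "(\<integral>\<^sup>+b. ennreal (measure K {b}) \<partial>count_space UNIV) = 1"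
    using emeasure_space_1 emeasure_countable_singleton[of UNIV K] assms(2)
    by (simp add: emeasure_eq_measure)
  then have pmf: "pmf (pmf_of_measure K) b = measure K {b}" for b
    unfolding pmf_of_measure_def by (intro pmf_embed_pmf) auto
  show ?thesis
  proof (rule measure_eqI_countable[where A = UNIV])
    show "emeasure (measure_pmf (pmf_of_measure K)) {a} = emeasure K {a}" for a
      by (simp add: emeasure_pmf_single pmf emeasure_eq_measure)
  qed (use assms(2) in auto)
qed

lemma pmf_pmf_of_measure:
  fixes K :: "'b::countable measure"
  assumes "prob_space K" "sets K = sets (count_space UNIV)"
  shows "pmf (pmf_of_measure K) b = measure K {b}"
  by (simp add: measure_pmf_single[symmetric] measure_pmf_of_measure[OF assms])

lemma measurable_emeasure_section:
  assumes "\<kappa> \<in> S \<rightarrow>\<^sub>M prob_algebra T" and F: "F \<in> sets (S \<Otimes>\<^sub>M T)"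
  shows "(\<lambda>s. emeasure (\<kappa> s) (Pair s -` F)) \<in> borel_measurable S"
proof -
  have "(SIGMA s:space S. Pair s -` F) = F"
    using sets.sets_into_space[OF F] by (auto simp: space_pair_measure)
  then show ?thesis
    using assms by (intro emeasure_measurable_subprob_algebra2[where N = T]) (auto intro: measurable_prob_algebraD)
qed

text \<open>The conditional law of the marks is given on cylinder sets only, whereas the event that a
  translated point hits a set depends jointly on the point and its translation.\<close>

lemma emeasure_kernel_section:
  fixes M :: "'w measure" and x :: "'w \<Rightarrow> 's" and z :: "'w \<Rightarrow> 't"
  assumes "finite_measure M" and [measurable]: "W \<in> sets M" "x \<in> M \<rightarrow>\<^sub>M S" "z \<in> M \<rightarrow>\<^sub>M T"
    and [measurable]: "c \<in> borel_measurable M" and \<kappa>: "\<kappa> \<in> S \<rightarrow>\<^sub>M prob_algebra T"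
    and rect: "\<And>U A. U \<in> sets S \<Longrightarrow> A \<in> sets T \<Longrightarrow>
      emeasure M {\<omega>\<in>W. x \<omega> \<in> U \<and> z \<omega> \<in> A}
        = (\<integral>\<^sup>+\<omega>. c \<omega> * indicator U (x \<omega>) * emeasure (\<kappa> (x \<omega>)) A \<partial>M)"
    and E: "E \<in> sets (S \<Otimes>\<^sub>M T)"
  shows "emeasure M {\<omega>\<in>W. (x \<omega>, z \<omega>) \<in> E} = (\<integral>\<^sup>+\<omega>. c \<omega> * emeasure (\<kappa> (x \<omega>)) (Pair (x \<omega>) -` E) \<partial>M)"
proof -
  interpret finite_measure M by fact
  have spW: "\<omega> \<in> space M" if "\<omega> \<in> W" for \<omega> using that sets.sets_into_space[of W M] by auto
  have \<kappa>x: "\<kappa> (x \<omega>) \<in> space (prob_algebra T)" if "\<omega> \<in> space M" for \<omega>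
    using that by (auto intro!: measurable_space[OF \<kappa>] measurable_space[of x M S])
  then have prob: "prob_space (\<kappa> (x \<omega>))" "sets (\<kappa> (x \<omega>)) = sets T" if "\<omega> \<in> space M" for \<omega>
    using that by (auto simp: space_prob_algebra)
  have meas: "(\<lambda>\<omega>. emeasure (\<kappa> (x \<omega>)) (Pair (x \<omega>) -` F)) \<in> borel_measurable M"
    if F: "F \<in> sets (S \<Otimes>\<^sub>M T)" for F
    by (rule measurable_compose[OF _ measurable_emeasure_section[OF \<kappa> F]]) simp
  have [measurable]: "Measurable.pred M (\<lambda>\<omega>. (x \<omega>, z \<omega>) \<in> F)" if "F \<in> sets (S \<Otimes>\<^sub>M T)" for F
    using that by measurable
  have ev: "{\<omega>\<in>W. (x \<omega>, z \<omega>) \<in> F} \<in> sets M" if "F \<in> sets (S \<Otimes>\<^sub>M T)" for F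
  proof -
    have "{\<omega>\<in>W. (x \<omega>, z \<omega>) \<in> F} = W \<inter> {\<omega>\<in>space M. (x \<omega>, z \<omega>) \<in> F}" using spW by auto
    then show ?thesis using that by simp
  qed
  let ?R = "{U \<times> A | U A. U \<in> sets S \<and> A \<in> sets T}"
  have sets_eq: "sets (S \<Otimes>\<^sub>M T) = sigma_sets (space S \<times> space T) ?R"
    by (rule sets_pair_measure)
  show ?thesis
    using Int_stable_pair_measure_generator pair_measure_closed E[unfolded sets_eq]
  proof (induction rule: sigma_sets_induct_disjoint)
    case (basic F)
    then obtain U A where F: "F = U \<times> A" "U \<in> sets S" "A \<in> sets T" by auto
    have "Pair s -` F = (if s \<in> U then A else {})" for s using F by auto
    then show ?case using rect[OF F(2,3)] unfolding F(1)
      by (auto intro!: nn_integral_cong simp: split: split_indicator)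
  next
    case empty
    show ?case by simp
  next
    case (compl F)
    then have F: "F \<in> sets (S \<Otimes>\<^sub>M T)" by (simp add: sets_eq)
    let ?\<Omega> = "space S \<times> space T"
    \<comment> \<open>The full rectangle, where the kernel contributes one, shows that
      \<open>c\<close> integrates to the finite mass of \<open>W\<close>. This is what makes the
      complement step a legitimate subtraction.\<close>
    have tot: "emeasure M W = (\<integral>\<^sup>+\<omega>. c \<omega> \<partial>M)"
    proof -
      have "{\<omega>\<in>W. x \<omega> \<in> space S \<and> z \<omega> \<in> space T} = W"
        using spW by (auto intro: measurable_space[of x M S] measurable_space[of z M T])
      then have "emeasure M W = (\<integral>\<^sup>+\<omega>. c \<omega> * indicator (space S) (x \<omega>) * emeasure (\<kappa> (x \<omega>)) (space T) \<partial>M)"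
        using rect[of "space S" "space T"] by simp
      also have "\<dots> = (\<integral>\<^sup>+\<omega>. c \<omega> \<partial>M)"
      proof (rule nn_integral_cong)
        fix \<omega> assume \<omega>: "\<omega> \<in> space M"
        have "emeasure (\<kappa> (x \<omega>)) (space T) = 1"
          using prob_space.emeasure_space_1[OF prob(1)[OF \<omega>]] sets_eq_imp_space_eq[OF prob(2)[OF \<omega>]] by simp
        then show "c \<omega> * indicator (space S) (x \<omega>) * emeasure (\<kappa> (x \<omega>)) (space T) = c \<omega>"
          using measurable_space[OF \<open>x \<in> M \<rightarrow>\<^sub>M S\<close> \<omega>] by simp
      qed
      finally show ?thesis .
    qed
    have "emeasure M {\<omega>\<in>W. (x \<omega>, z \<omega>) \<in> ?\<Omega> - F} = emeasure M (W - {\<omega>\<in>W. (x \<omega>, z \<omega>) \<in> F})"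
      using spW by (intro arg_cong[where f = "emeasure M"])
        (auto intro: measurable_space[of x M S] measurable_space[of z M T])
    also have "\<dots> = emeasure M W - emeasure M {\<omega>\<in>W. (x \<omega>, z \<omega>) \<in> F}"
      using ev[OF F] by (intro emeasure_Diff) auto
    also have "\<dots> = (\<integral>\<^sup>+\<omega>. c \<omega> \<partial>M) - (\<integral>\<^sup>+\<omega>. c \<omega> * emeasure (\<kappa> (x \<omega>)) (Pair (x \<omega>) -` F) \<partial>M)"
      using compl tot by simp
    also have "\<dots> = (\<integral>\<^sup>+\<omega>. c \<omega> - c \<omega> * emeasure (\<kappa> (x \<omega>)) (Pair (x \<omega>) -` F) \<partial>M)"
    proof (rule nn_integral_diff[symmetric])
      show "(\<lambda>\<omega>. c \<omega> * emeasure (\<kappa> (x \<omega>)) (Pair (x \<omega>) -` F)) \<in> borel_measurable M"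
        using meas[OF F] by measurable
      have "emeasure M {\<omega>\<in>W. (x \<omega>, z \<omega>) \<in> F} < \<infinity>" by (simp add: less_top[symmetric])
      then show "(\<integral>\<^sup>+\<omega>. c \<omega> * emeasure (\<kappa> (x \<omega>)) (Pair (x \<omega>) -` F) \<partial>M) \<noteq> \<infinity>"
        using compl by simp
      show "AE \<omega> in M. c \<omega> * emeasure (\<kappa> (x \<omega>)) (Pair (x \<omega>) -` F) \<le> c \<omega>"
      proof (rule AE_I2)
        fix \<omega> assume "\<omega> \<in> space M"
        then have "emeasure (\<kappa> (x \<omega>)) (Pair (x \<omega>) -` F) \<le> 1"
          using prob_space.emeasure_le_1[OF prob(1)] by simp
        then show "c \<omega> * emeasure (\<kappa> (x \<omega>)) (Pair (x \<omega>) -` F) \<le> c \<omega>"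
          using mult_left_mono[of _ 1 "c \<omega>"] by simp
      qed
    qed simp
    also have "\<dots> = (\<integral>\<^sup>+\<omega>. c \<omega> * emeasure (\<kappa> (x \<omega>)) (Pair (x \<omega>) -` (?\<Omega> - F)) \<partial>M)"
    proof (rule nn_integral_cong_AE)
      have "(\<integral>\<^sup>+\<omega>. c \<omega> \<partial>M) \<noteq> \<infinity>" using tot[symmetric] by simp
      \<comment> \<open>Multiplication by \<open>c\<close> distributes over the truncated
        subtraction of \<open>ennreal\<close> where \<open>c\<close> is finite, which its finite
        integral gives almost everywhere.\<close>
      then have "AE \<omega> in M. c \<omega> \<noteq> \<infinity>" using nn_integral_noteq_infinite[of c M] by simp
      from this AE_space show "AE \<omega> in M. c \<omega> - c \<omega> * emeasure (\<kappa> (x \<omega>)) (Pair (x \<omega>) -` F)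
            = c \<omega> * emeasure (\<kappa> (x \<omega>)) (Pair (x \<omega>) -` (?\<Omega> - F))"
      proof eventually_elim
        fix \<omega> assume c: "c \<omega> \<noteq> \<infinity>" and \<omega>: "\<omega> \<in> space M"
        interpret K: prob_space "\<kappa> (x \<omega>)" by (rule prob(1)[OF \<omega>])
        have sp: "space (\<kappa> (x \<omega>)) = space T" by (rule sets_eq_imp_space_eq[OF prob(2)[OF \<omega>]])
        have "Pair (x \<omega>) -` (?\<Omega> - F) = space (\<kappa> (x \<omega>)) - Pair (x \<omega>) -` F"
          using measurable_space[OF \<open>x \<in> M \<rightarrow>\<^sub>M S\<close> \<omega>] sp by auto
        moreover have "Pair (x \<omega>) -` F \<in> sets (\<kappa> (x \<omega>))"
          using sets_Pair1[OF F] prob \<omega> by simp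
        ultimately have "emeasure (\<kappa> (x \<omega>)) (Pair (x \<omega>) -` (?\<Omega> - F)) = 1 - emeasure (\<kappa> (x \<omega>)) (Pair (x \<omega>) -` F)"
          using emeasure_compl[of "Pair (x \<omega>) -` F" "\<kappa> (x \<omega>)"] K.emeasure_space_1 by simp
        then show "c \<omega> - c \<omega> * emeasure (\<kappa> (x \<omega>)) (Pair (x \<omega>) -` F)
            = c \<omega> * emeasure (\<kappa> (x \<omega>)) (Pair (x \<omega>) -` (?\<Omega> - F))"
          using c by (simp add: ennreal_right_diff_distrib)
      qed
    qed
    finally show ?case .
  next
    case (union F)
    then have F: "F i \<in> sets (S \<Otimes>\<^sub>M T)" for i by (auto simp: sets_eq)
    have "emeasure M {\<omega>\<in>W. (x \<omega>, z \<omega>) \<in> (\<Union>i. F i)} = (\<Sum>i. emeasure M {\<omega>\<in>W. (x \<omega>, z \<omega>) \<in> F i})"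
      using union(1) ev[OF F]
      by (subst suminf_emeasure) (auto simp: disjoint_family_on_def intro!: arg_cong[where f = "emeasure M"])
    also have "\<dots> = (\<integral>\<^sup>+\<omega>. (\<Sum>i. c \<omega> * emeasure (\<kappa> (x \<omega>)) (Pair (x \<omega>) -` F i)) \<partial>M)"
      unfolding union(3) using meas[OF F] by (intro nn_integral_suminf[symmetric]) measurable
    also have "\<dots> = (\<integral>\<^sup>+\<omega>. c \<omega> * emeasure (\<kappa> (x \<omega>)) (Pair (x \<omega>) -` (\<Union>i. F i)) \<partial>M)"
    proof (rule nn_integral_cong)
      fix \<omega> assume \<omega>: "\<omega> \<in> space M"
      have "(\<Sum>i. emeasure (\<kappa> (x \<omega>)) (Pair (x \<omega>) -` F i)) = emeasure (\<kappa> (x \<omega>)) (\<Union>i. Pair (x \<omega>) -` F i)"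
        using union(1) sets_Pair1[OF F] prob(2)[OF \<omega>]
        by (intro suminf_emeasure) (auto simp: disjoint_family_on_def)
      then show "(\<Sum>i. c \<omega> * emeasure (\<kappa> (x \<omega>)) (Pair (x \<omega>) -` F i))
          = c \<omega> * emeasure (\<kappa> (x \<omega>)) (Pair (x \<omega>) -` (\<Union>i. F i))"
        by (simp add: vimage_Union vimage_UN)
    qed
    finally show ?case .
  qed
qed

lemma Ball_fun_upd:
  "k \<in> J \<Longrightarrow> (\<forall>j\<in>J. P j ((C(k := E)) j)) \<longleftrightarrow> P k E \<and> (\<forall>j\<in>J - {k}. P j (C j))"
  by auto

locale marked_process = prob_space M for M :: "'w measure" +
  fixes \<Phi> :: "'w \<Rightarrow> 'a::euclidean_space measure" and N :: "'a \<Rightarrow> nat measure" and X :: "'a \<Rightarrow> 'a measure"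
    and \<xi> :: "nat \<Rightarrow> 'a measure \<Rightarrow> 'a" and \<nu> :: "nat \<Rightarrow> 'w \<Rightarrow> nat" and y :: "nat \<Rightarrow> nat \<Rightarrow> 'w \<Rightarrow> 'a"
  assumes measurable_process [measurable]: "\<Phi> \<in> M \<rightarrow>\<^sub>M counting_measures"
    and enum: "point_enumeration \<xi>"
    and marks: "perturbation_marks M \<Phi> N X \<xi> \<nu> y"
    and replication_kernel [measurable]: "N \<in> borel \<rightarrow>\<^sub>M prob_algebra (count_space UNIV)"
    and translation_kernel [measurable]: "X \<in> borel \<rightarrow>\<^sub>M prob_algebra borel"
begin

abbreviation \<F> :: "'w measure" where
  "\<F> \<equiv> vimage_algebra (space M) \<Phi> counting_measures"

abbreviation x :: "nat \<Rightarrow> 'w \<Rightarrow> 'a" where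
  "x n \<omega> \<equiv> \<xi> n (\<Phi> \<omega>)"

lemma measurable_enum [measurable]: "\<xi> n \<in> counting_measures \<rightarrow>\<^sub>M borel"
  using enum by (simp add: point_enumeration_def)

lemma measurable_marks [measurable]: "\<nu> n \<in> M \<rightarrow>\<^sub>M count_space UNIV" "y n i \<in> M \<rightarrow>\<^sub>M borel"
  using marks by (simp_all add: perturbation_marks_def)

lemma measurable_\<F>: "\<Phi> \<in> \<F> \<rightarrow>\<^sub>M counting_measures"
  using measurable_space[OF measurable_process] by (intro measurable_vimage_algebra1) auto

lemma subalgebra_\<F>: "subalgebra M \<F>"
proof -
  have "space M = space \<F>" by simp
  moreover have "sets \<F> \<subseteq> sets M"
    using measurable_sets[OF measurable_process] measurable_space[OF measurable_process]
    by (auto simp: sets_vimage_algebra2)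
  ultimately show ?thesis by (simp add: subalgebra_def)
qed

lemma sets_\<F>: "G \<in> sets \<F> \<Longrightarrow> G \<in> sets M"
  using subalgebra_\<F> by (auto simp: subalgebra_def)

lemma prob_kernels: "prob_space (N z)" "sets (N z) = UNIV" "prob_space (X z)" "sets (X z) = sets borel"
  using measurable_space[OF replication_kernel, of z] measurable_space[OF translation_kernel, of z]
  by (auto simp: space_prob_algebra)

text \<open>Integrating the conditional probability over an event \<open>G\<close> of
  \<open>\<F>\<close> removes the conditioning. The inclusion of \<open>G\<close> in the event of at
  least \<open>m\<close> points is needed because the marks have a prescribed law only there; on
  \<open>G\<close> the product formula can then be substituted almost surely.\<close>

lemma emeasure_marks_rect:
  assumes G: "G \<in> sets \<F>" "\<And>\<omega>. \<omega> \<in> G \<Longrightarrow> of_nat m \<le> emeasure (\<Phi> \<omega>) UNIV"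
    and A [measurable]: "\<And>n i. A n i \<in> sets borel"
  shows "emeasure M {\<omega>\<in>G. \<forall>n<m. \<nu> n \<omega> \<in> D n \<and> (\<forall>i<l. y n i \<omega> \<in> A n i)} =
    (\<integral>\<^sup>+\<omega>. indicator G \<omega> * (\<Prod>n<m. emeasure (N (x n \<omega>)) (D n) * (\<Prod>i<l. emeasure (X (x n \<omega>)) (A n i))) \<partial>M)"
proof -
  interpret finite_measure_subalgebra M \<F>
    by unfold_locales (rule subalgebra_\<F>)
  define S where "S = {\<omega>\<in>space M. \<forall>n<m. \<nu> n \<omega> \<in> D n \<and> (\<forall>i<l. y n i \<omega> \<in> A n i)}"
  have S [measurable]: "S \<in> sets M" unfolding S_def by measurable
  have GM [measurable]: "G \<in> sets M" using G(1) by (rule sets_\<F>)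
  have int: "integrable M (indicator S :: 'w \<Rightarrow> real)"
    by (intro integrable_real_indicator) (auto simp: emeasure_eq_measure)
  let ?R = "real_cond_exp M \<F> (indicator S)"
  let ?P = "\<lambda>\<omega>. \<Prod>n<m. measure (N (x n \<omega>)) (D n) * (\<Prod>i<l. measure (X (x n \<omega>)) (A n i))"
  have P0: "?P \<omega> \<ge> 0" for \<omega>
    by (intro prod_nonneg ballI mult_nonneg_nonneg) auto
  have "AE \<omega> in M. of_nat m \<le> emeasure (\<Phi> \<omega>) UNIV \<longrightarrow> ?R \<omega> = ?P \<omega>"
    using marks A unfolding perturbation_marks_def S_def by blast
  then have R: "AE \<omega> in M. indicator G \<omega> * ?R \<omega> = indicator G \<omega> * ?P \<omega>"
    by eventually_elim (use G(2) in \<open>auto split: split_indicator\<close>)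
  have "measure M (G \<inter> S) = (\<integral>\<omega>\<in>G. indicator S \<omega> \<partial>M)"
    by (simp add: set_lebesgue_integral_def indicator_inter_arith[symmetric])
  also have "\<dots> = (\<integral>\<omega>. indicator G \<omega> * ?R \<omega> \<partial>M)"
    using real_cond_exp_intA[OF int G(1)] by (simp add: set_lebesgue_integral_def)
  finally have "emeasure M (G \<inter> S) = ennreal (\<integral>\<omega>. indicator G \<omega> * ?R \<omega> \<partial>M)"
    by (simp add: emeasure_eq_measure)
  also have "\<dots> = (\<integral>\<^sup>+\<omega>. ennreal (indicator G \<omega> * ?R \<omega>) \<partial>M)"
  proof (rule nn_integral_eq_integral[symmetric])
    show "integrable M (\<lambda>\<omega>. indicator G \<omega> * ?R \<omega>)"
      using integrable_mult_indicator[OF GM real_cond_exp_int(1)[OF int]] by simp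
    show "AE \<omega> in M. 0 \<le> indicator G \<omega> * ?R \<omega>"
      using R by eventually_elim (use P0 in \<open>auto split: split_indicator\<close>)
  qed
  also have "\<dots> = (\<integral>\<^sup>+\<omega>. indicator G \<omega> * (\<Prod>n<m. emeasure (N (x n \<omega>)) (D n) * (\<Prod>i<l. emeasure (X (x n \<omega>)) (A n i))) \<partial>M)"
  proof (rule nn_integral_cong_AE, use R in eventually_elim)
    fix \<omega> assume R: "indicator G \<omega> * ?R \<omega> = indicator G \<omega> * ?P \<omega>"
    have "emeasure (N (x n \<omega>)) B = ennreal (measure (N (x n \<omega>)) B)" "emeasure (X (x n \<omega>)) B' = ennreal (measure (X (x n \<omega>)) B')" for n B B'
      using prob_kernels by (auto simp: prob_space_def finite_measure.emeasure_eq_measure)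
    then have "(\<Prod>n<m. emeasure (N (x n \<omega>)) (D n) * (\<Prod>i<l. emeasure (X (x n \<omega>)) (A n i))) = ennreal (?P \<omega>)"
      by (subst prod_ennreal[symmetric]) (auto simp: prod_ennreal ennreal_mult prod_nonneg)
    then show "ennreal (indicator G \<omega> * ?R \<omega>) =
        indicator G \<omega> * (\<Prod>n<m. emeasure (N (x n \<omega>)) (D n) * (\<Prod>i<l. emeasure (X (x n \<omega>)) (A n i)))"
      unfolding R by (auto split: split_indicator)
  qed
  also have "G \<inter> S = {\<omega>\<in>G. \<forall>n<m. \<nu> n \<omega> \<in> D n \<and> (\<forall>i<l. y n i \<omega> \<in> A n i)}"
    using sets.sets_into_space[OF GM] by (auto simp: S_def)
  finally show ?thesis .
qed

text \<open>Coordinates are released one at a time: \<open>K\<close> collects the indices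
  \<open>j\<close> at which \<open>C j\<close> may be an arbitrary subset of the product, while at
  all other indices it constrains the translation only. Each step applies
  \<open>emeasure_kernel_section\<close> to one pair of a point and its translation.\<close>

lemma emeasure_marks_joint:
  fixes C :: "nat \<times> nat \<Rightarrow> ('a \<times> 'a) set"
  assumes "G \<in> sets \<F>" "\<And>\<omega>. \<omega> \<in> G \<Longrightarrow> of_nat m \<le> emeasure (\<Phi> \<omega>) UNIV"
    and "\<And>j. C j \<in> sets (borel \<Otimes>\<^sub>M borel)"
  shows "emeasure M {\<omega>\<in>G. (\<forall>n<m. \<nu> n \<omega> \<in> D n) \<and>
            (\<forall>j\<in>{..<m} \<times> {..<l}. (x (fst j) \<omega>, y (fst j) (snd j) \<omega>) \<in> C j)} =
    (\<integral>\<^sup>+\<omega>. indicator G \<omega> * (\<Prod>n<m. emeasure (N (x n \<omega>)) (D n)) *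
       (\<Prod>j\<in>{..<m} \<times> {..<l}. emeasure (X (x (fst j) \<omega>)) (Pair (x (fst j) \<omega>) -` C j)) \<partial>M)"
proof -
  let ?J = "{..<m} \<times> {..<l}"
  have "emeasure M {\<omega>\<in>G. (\<forall>n<m. \<nu> n \<omega> \<in> D n) \<and>
            (\<forall>j\<in>?J. (x (fst j) \<omega>, y (fst j) (snd j) \<omega>) \<in> C j)} =
    (\<integral>\<^sup>+\<omega>. indicator G \<omega> * (\<Prod>n<m. emeasure (N (x n \<omega>)) (D n)) *
       (\<Prod>j\<in>?J. emeasure (X (x (fst j) \<omega>)) (Pair (x (fst j) \<omega>) -` C j)) \<partial>M)"
    if "finite K" "K \<subseteq> ?J" "G \<in> sets \<F>" "\<And>\<omega>. \<omega> \<in> G \<Longrightarrow> of_nat m \<le> emeasure (\<Phi> \<omega>) UNIV"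
      "\<And>j. C j \<in> sets (borel \<Otimes>\<^sub>M borel)" "\<And>j. j \<notin> K \<Longrightarrow> \<exists>A\<in>sets borel. C j = UNIV \<times> A"
    for K G C
    using that
  proof (induction K arbitrary: G C rule: finite_induct)
    case empty
    then obtain A where A: "\<And>j. A j \<in> sets borel" "\<And>j. C j = UNIV \<times> A j" by (metis empty_iff)
    have "{\<omega>\<in>G. (\<forall>n<m. \<nu> n \<omega> \<in> D n) \<and> (\<forall>j\<in>?J. (x (fst j) \<omega>, y (fst j) (snd j) \<omega>) \<in> C j)}
        = {\<omega>\<in>G. \<forall>n<m. \<nu> n \<omega> \<in> D n \<and> (\<forall>i<l. y n i \<omega> \<in> A (n, i))}"
      by (auto simp: A(2))
    moreover have "Pair z -` C j = A j" for z j by (auto simp: A(2))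
    ultimately show ?case
      using emeasure_marks_rect[OF empty(2,3), of "\<lambda>n i. A (n, i)" D l] A(1)
      by (simp add: prod.distrib prod.cartesian_product split_beta mult.assoc)
  next
    case (insert k K)
    have [measurable]: "G \<in> sets M" using insert.prems(2) by (rule sets_\<F>)
    have k: "k \<in> ?J" using insert.prems by auto
    have [measurable]: "C j \<in> sets (borel \<Otimes>\<^sub>M borel)" for j by (rule insert.prems)
    have sec [measurable]: "(\<lambda>\<omega>. emeasure (X (x n \<omega>)) (Pair (x n \<omega>) -` C j)) \<in> borel_measurable M" for n j
      by (rule measurable_compose[OF _ measurable_emeasure_section[OF translation_kernel]]) auto
    have [measurable]: "(\<lambda>\<omega>. emeasure (N (x n \<omega>)) (D n)) \<in> borel_measurable M" for n
      by (rule measurable_compose[OF _ measurable_emeasure_kernel[OF measurable_prob_algebraD[OF replication_kernel]]]) auto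
    \<comment> \<open>All requirements except the one at index \<open>k\<close>, as an event
      \<open>W\<close> and as the corresponding density \<open>c\<close>; the requirement at
      \<open>k\<close> then ranges over a rectangle or over \<open>C k\<close>.\<close>
    define W where "W = {\<omega>\<in>G. (\<forall>n<m. \<nu> n \<omega> \<in> D n) \<and>
       (\<forall>j\<in>?J - {k}. (x (fst j) \<omega>, y (fst j) (snd j) \<omega>) \<in> C j)}"
    define c where "c \<omega> = indicator G \<omega> * (\<Prod>n<m. emeasure (N (x n \<omega>)) (D n)) *
       (\<Prod>j\<in>?J - {k}. emeasure (X (x (fst j) \<omega>)) (Pair (x (fst j) \<omega>) -` C j))" for \<omega>
    have Wk: "{\<omega>\<in>W. (x (fst k) \<omega>, y (fst k) (snd k) \<omega>) \<in> E} = {\<omega>\<in>G. (\<forall>n<m. \<nu> n \<omega> \<in> D n) \<and>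
            (\<forall>j\<in>?J. (x (fst j) \<omega>, y (fst j) (snd j) \<omega>) \<in> (C(k := E)) j)}" for E
    proof (rule set_eqI)
      fix \<omega>
      have "(\<forall>j\<in>?J. (x (fst j) \<omega>, y (fst j) (snd j) \<omega>) \<in> (C(k := E)) j) \<longleftrightarrow>
          (x (fst k) \<omega>, y (fst k) (snd k) \<omega>) \<in> E \<and> (\<forall>j\<in>?J - {k}. (x (fst j) \<omega>, y (fst j) (snd j) \<omega>) \<in> C j)"
        using Ball_fun_upd[OF k, of "\<lambda>j S. (x (fst j) \<omega>, y (fst j) (snd j) \<omega>) \<in> S" C E] .
      then show "\<omega> \<in> {\<omega>\<in>W. (x (fst k) \<omega>, y (fst k) (snd k) \<omega>) \<in> E} \<longleftrightarrow> \<omega> \<in> {\<omega>\<in>G. (\<forall>n<m. \<nu> n \<omega> \<in> D n) \<and>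
            (\<forall>j\<in>?J. (x (fst j) \<omega>, y (fst j) (snd j) \<omega>) \<in> (C(k := E)) j)}"
        unfolding W_def by blast
    qed
    have ck: "indicator G \<omega> * (\<Prod>n<m. emeasure (N (x n \<omega>)) (D n)) *
       (\<Prod>j\<in>?J. emeasure (X (x (fst j) \<omega>)) (Pair (x (fst j) \<omega>) -` (C(k := E)) j))
      = c \<omega> * emeasure (X (x (fst k) \<omega>)) (Pair (x (fst k) \<omega>) -` E)" for E \<omega>
      using k by (subst prod.remove[of ?J k]) (auto simp: c_def ac_simps intro!: prod.cong)
    have "W = G \<inter> {\<omega>\<in>space M. (\<forall>n<m. \<nu> n \<omega> \<in> D n) \<and>
       (\<forall>j\<in>?J - {k}. (x (fst j) \<omega>, y (fst j) (snd j) \<omega>) \<in> C j)}"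
      using sets.sets_into_space[OF \<open>G \<in> sets M\<close>] by (auto simp: W_def)
    then have [measurable]: "W \<in> sets M" by simp
    have [measurable]: "c \<in> borel_measurable M" unfolding c_def by measurable
    have "emeasure M {\<omega>\<in>W. (x (fst k) \<omega>, y (fst k) (snd k) \<omega>) \<in> C k}
      = (\<integral>\<^sup>+\<omega>. c \<omega> * emeasure (X (x (fst k) \<omega>)) (Pair (x (fst k) \<omega>) -` C k) \<partial>M)"
    proof (rule emeasure_kernel_section[OF finite_measure_axioms _ _ _ _ translation_kernel])
      fix U A :: "'a set" assume U [measurable]: "U \<in> sets borel" and A [measurable]: "A \<in> sets borel"
      \<comment> \<open>For a rectangle the two factors go different ways: the condition on the
        point is a condition on \<open>\<Phi>\<close> and is absorbed into the event of
        \<open>\<F>\<close>, while the condition on the translation is again a cylinder. Hence the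
        induction hypothesis must hold for all \<open>G\<close> and \<open>C\<close>.\<close>
      let ?G = "{\<omega>\<in>G. x (fst k) \<omega> \<in> U}"
      have "{\<omega>\<in>space \<F>. x (fst k) \<omega> \<in> U} \<in> sets \<F>"
        using measurable_sets[OF measurable_compose[OF measurable_\<F> measurable_enum] U]
        by (simp add: vimage_def Int_def conj_commute)
      then have "G \<inter> {\<omega>\<in>space \<F>. x (fst k) \<omega> \<in> U} \<in> sets \<F>" using insert.prems(2) by blast
      also have "G \<inter> {\<omega>\<in>space \<F>. x (fst k) \<omega> \<in> U} = ?G"
        using sets.sets_into_space[OF insert.prems(2)] by auto
      finally have G': "?G \<in> sets \<F>" .
      have "emeasure M {\<omega>\<in>?G. (\<forall>n<m. \<nu> n \<omega> \<in> D n) \<and>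
            (\<forall>j\<in>?J. (x (fst j) \<omega>, y (fst j) (snd j) \<omega>) \<in> (C(k := UNIV \<times> A)) j)} =
        (\<integral>\<^sup>+\<omega>. indicator ?G \<omega> * (\<Prod>n<m. emeasure (N (x n \<omega>)) (D n)) *
       (\<Prod>j\<in>?J. emeasure (X (x (fst j) \<omega>)) (Pair (x (fst j) \<omega>) -` (C(k := UNIV \<times> A)) j)) \<partial>M)"
      proof (rule insert.IH[OF _ G'])
        show "K \<subseteq> ?J" using insert.prems by auto
        show "of_nat m \<le> emeasure (\<Phi> \<omega>) UNIV" if "\<omega> \<in> ?G" for \<omega> using that insert.prems by auto
        show "(C(k := UNIV \<times> A)) j \<in> sets (borel \<Otimes>\<^sub>M borel)" for j by auto
        show "\<exists>A'\<in>sets borel. (C(k := UNIV \<times> A)) j = UNIV \<times> A'" if "j \<notin> K" for j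
          using insert.prems(5)[of j] that A by auto
      qed
      also have "\<dots> = (\<integral>\<^sup>+\<omega>. indicator U (x (fst k) \<omega>) * (indicator G \<omega> * (\<Prod>n<m. emeasure (N (x n \<omega>)) (D n)) *
       (\<Prod>j\<in>?J. emeasure (X (x (fst j) \<omega>)) (Pair (x (fst j) \<omega>) -` (C(k := UNIV \<times> A)) j))) \<partial>M)"
        by (intro nn_integral_cong) (auto split: split_indicator)
      also have "\<dots> = (\<integral>\<^sup>+\<omega>. c \<omega> * indicator U (x (fst k) \<omega>) * emeasure (X (x (fst k) \<omega>)) A \<partial>M)"
        unfolding ck by (intro nn_integral_cong) (auto simp: ac_simps vimage_def)
      also have "{\<omega>\<in>?G. (\<forall>n<m. \<nu> n \<omega> \<in> D n) \<and>
            (\<forall>j\<in>?J. (x (fst j) \<omega>, y (fst j) (snd j) \<omega>) \<in> (C(k := UNIV \<times> A)) j)}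
          = {\<omega>\<in>W. (x (fst k) \<omega>, y (fst k) (snd k) \<omega>) \<in> U \<times> A}"
        unfolding Wk using k by auto
      finally show "emeasure M {\<omega>\<in>W. x (fst k) \<omega> \<in> U \<and> y (fst k) (snd k) \<omega> \<in> A}
          = (\<integral>\<^sup>+\<omega>. c \<omega> * indicator U (x (fst k) \<omega>) * emeasure (X (x (fst k) \<omega>)) A \<partial>M)" by simp
    qed measurable
    then show ?case unfolding Wk ck[symmetric] by simp
  qed
  note * = this
  \<comment> \<open>Indices outside the finite grid do not occur in the claim; setting
    \<open>C\<close> to \<open>UNIV\<close> there makes the choice of the whole grid for
    \<open>K\<close> admissible.\<close>
  have "\<exists>A\<in>sets borel. (if j \<in> ?J then C j else UNIV) = UNIV \<times> A" if "j \<notin> ?J" for j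
    using that by (intro bexI[of _ UNIV]) auto
  moreover have "(if j \<in> ?J then C j else UNIV) \<in> sets (borel \<Otimes>\<^sub>M borel)" for j
    using assms(3)[of j] sets.top[of "borel \<Otimes>\<^sub>M borel :: ('a \<times> 'a) measure"] by (simp add: space_pair_measure)
  ultimately show ?thesis
    using *[of ?J G "\<lambda>j. if j \<in> ?J then C j else UNIV"] assms(1,2)
    by (simp only: finite_cartesian_product finite_lessThan order.refl simp_thms if_True cong: ball_cong prod.cong)
qed

end

section \<open>Discrete types of replicas\<close>

locale typed_marked_process = marked_process M \<Phi> N X \<xi> \<nu> y
  for M :: "'w measure" and \<Phi> :: "'w \<Rightarrow> 'a::euclidean_space measure" and N X \<xi> \<nu> y +
  fixes \<tau> :: "'a \<Rightarrow> 'b::countable"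
  assumes measurable_type [measurable]: "\<tau> \<in> borel \<rightarrow>\<^sub>M count_space UNIV"
begin

definition types :: "nat \<Rightarrow> 'w \<Rightarrow> 'b list" where
  "types n \<omega> = map (\<lambda>i. \<tau> (x n \<omega> + y n i \<omega>)) [0..<\<nu> n \<omega>]"

definition types_pmf :: "'a \<Rightarrow> 'b list pmf" where
  "types_pmf z = list_pmf (pmf_of_measure (N z)) (pmf_of_measure (distr (X z) (count_space UNIV) (\<lambda>u. \<tau> (z + u))))"

lemma pmf_replicas: "pmf (pmf_of_measure (N z)) d = measure (N z) {d}"
  by (intro pmf_pmf_of_measure) (simp_all add: prob_kernels)

lemma pmf_type:
  "pmf (pmf_of_measure (distr (X z) (count_space UNIV) (\<lambda>u. \<tau> (z + u)))) b = measure (X z) {u. \<tau> (z + u) = b}"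
proof -
  have [measurable]: "(\<lambda>u. \<tau> (z + u)) \<in> X z \<rightarrow>\<^sub>M count_space UNIV"
    unfolding measurable_cong_sets[OF prob_kernels(4) refl] by measurable
  have sp: "space (X z) = UNIV" using sets_eq_imp_space_eq[OF prob_kernels(4)[of z]] by simp
  show ?thesis
    by (subst pmf_pmf_of_measure) (simp_all add: prob_space.prob_space_distr prob_kernels measure_distr vimage_def sp)
qed

lemma sets_type_sum [measurable]: "{p. \<tau> (fst p + snd p) = b} \<in> sets (borel \<Otimes>\<^sub>M borel)"
proof -
  have "(\<lambda>p :: 'a \<times> 'a. \<tau> (fst p + snd p)) \<in> borel \<Otimes>\<^sub>M borel \<rightarrow>\<^sub>M count_space UNIV"
    by measurable
  from measurable_sets[OF this, of "{b}"] show ?thesis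
    by (simp add: vimage_def space_pair_measure)
qed

lemma measurable_pmf_types [measurable]: "(\<lambda>z. pmf (types_pmf z) ws) \<in> borel_measurable borel"
proof -
  have [measurable]: "(\<lambda>z. measure (X z) {u. \<tau> (z + u) = b}) \<in> borel_measurable borel" for b
  proof -
    have "(\<lambda>z. emeasure (X z) (Pair z -` {p. \<tau> (fst p + snd p) = b})) \<in> borel_measurable borel"
      by (rule measurable_emeasure_section[OF translation_kernel sets_type_sum])
    then show ?thesis by (simp add: measure_def vimage_def)
  qed
  have [measurable]: "(\<lambda>z. prod_list (map (\<lambda>b. measure (X z) {u. \<tau> (z + u) = b}) ws)) \<in> borel_measurable borel"
    by (induction ws) simp_all
  have [measurable]: "(\<lambda>z. measure (N z) {d}) \<in> borel_measurable borel" for d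
    using measurable_emeasure_kernel[OF measurable_prob_algebraD[OF replication_kernel], of "{d}"] by (simp add: measure_def)
  show ?thesis
    unfolding types_pmf_def pmf_list_pmf pmf_replicas pmf_type by measurable
qed

lemma types_eq_iff:
  "types n \<omega> = ws \<longleftrightarrow> \<nu> n \<omega> = length ws \<and> (\<forall>i<length ws. \<tau> (x n \<omega> + y n i \<omega>) = ws ! i)"
  unfolding types_def list_eq_iff_nth_eq by auto

lemma measurable_types [measurable]: "types n \<in> M \<rightarrow>\<^sub>M count_space UNIV"
proof (rule measurable_count_space_eq_countable[THEN iffD2, OF _ conjI])
  show "\<forall>ws\<in>UNIV. types n -` {ws} \<inter> space M \<in> sets M"
  proof
    fix ws :: "'b list"
    have "types n -` {ws} \<inter> space M =
      {\<omega>\<in>space M. \<nu> n \<omega> = length ws \<and> (\<forall>i<length ws. \<tau> (x n \<omega> + y n i \<omega>) = ws ! i)}"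
      by (simp add: vimage_def Int_def types_eq_iff conj_commute)
    also have "\<dots> = (\<nu> n -` {length ws} \<inter> space M) \<inter>
        {\<omega>\<in>space M. \<forall>i\<in>{..<length ws}. \<tau> (x n \<omega> + y n i \<omega>) = ws ! i}" by auto
    also have "\<dots> \<in> sets M"
    proof (rule sets.Int)
      show "\<nu> n -` {length ws} \<inter> space M \<in> sets M"
        by (rule measurable_sets[OF measurable_marks(1)]) simp
      have type: "(\<lambda>\<omega>. \<tau> (x n \<omega> + y n i \<omega>)) \<in> M \<rightarrow>\<^sub>M count_space UNIV" for i by measurable
      have "{\<omega>\<in>space M. \<tau> (x n \<omega> + y n i \<omega>) = ws ! i} \<in> sets M" for i
        using measurable_sets[OF type[of i], of "{ws ! i}"] by (simp add: vimage_def Int_def conj_commute)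
      then show "{\<omega>\<in>space M. \<forall>i\<in>{..<length ws}. \<tau> (x n \<omega> + y n i \<omega>) = ws ! i} \<in> sets M"
        by (intro sets.sets_Collect_finite_All) auto
    qed
    finally show "types n -` {ws} \<inter> space M \<in> sets M" .
  qed
qed simp_all

lemma emeasure_types:
  assumes G: "G \<in> sets \<F>" "\<And>\<omega>. \<omega> \<in> G \<Longrightarrow> of_nat m \<le> emeasure (\<Phi> \<omega>) UNIV"
  shows "emeasure M {\<omega>\<in>G. \<forall>n<m. types n \<omega> = ws n} =
    (\<integral>\<^sup>+\<omega>. indicator G \<omega> * (\<Prod>n<m. ennreal (pmf (types_pmf (x n \<omega>)) (ws n))) \<partial>M)"
proof -
  \<comment> \<open>The prescribed laws use one number of translations for all points; the sum of
    the lengths serves as a common upper bound.\<close>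
  define l where "l = (\<Sum>n<m. length (ws n))"
  have l: "length (ws n) \<le> l" if "n < m" for n
    unfolding l_def using that by (intro member_le_sum) auto
  \<comment> \<open>Translations beyond the length of the list \<open>ws n\<close> are left free,
    and contribute a factor one.\<close>
  define C where "C j = (if snd j < length (ws (fst j)) then {p :: 'a \<times> 'a. \<tau> (fst p + snd p) = ws (fst j) ! snd j} else UNIV)" for j
  have C: "C j \<in> sets (borel \<Otimes>\<^sub>M borel)" for j
    using sets.top[of "borel \<Otimes>\<^sub>M borel :: ('a \<times> 'a) measure"]
    by (cases "snd j < length (ws (fst j))") (simp_all add: C_def sets_type_sum space_pair_measure)
  have "{\<omega>\<in>G. \<forall>n<m. types n \<omega> = ws n} = {\<omega>\<in>G. (\<forall>n<m. \<nu> n \<omega> \<in> {length (ws n)}) \<and>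
            (\<forall>j\<in>{..<m} \<times> {..<l}. (x (fst j) \<omega>, y (fst j) (snd j) \<omega>) \<in> C j)}"
  proof (intro Collect_cong conj_cong refl)
    fix \<omega>
    have "types n \<omega> = ws n \<longleftrightarrow> \<nu> n \<omega> = length (ws n) \<and> (\<forall>i<l. (x n \<omega>, y n i \<omega>) \<in> C (n, i))" if "n < m" for n
    proof -
      have "(\<forall>i<l. (x n \<omega>, y n i \<omega>) \<in> C (n, i)) \<longleftrightarrow> (\<forall>i<length (ws n). \<tau> (x n \<omega> + y n i \<omega>) = ws n ! i)"
        using l[OF that] by (auto simp: C_def)
      then show ?thesis unfolding types_eq_iff by auto
    qed
    then show "(\<forall>n<m. types n \<omega> = ws n) \<longleftrightarrow> (\<forall>n<m. \<nu> n \<omega> \<in> {length (ws n)}) \<and>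
            (\<forall>j\<in>{..<m} \<times> {..<l}. (x (fst j) \<omega>, y (fst j) (snd j) \<omega>) \<in> C j)"
      by (auto simp: Ball_def)
  qed
  moreover have "(\<Prod>n<m. emeasure (N (x n \<omega>)) {length (ws n)}) *
       (\<Prod>j\<in>{..<m} \<times> {..<l}. emeasure (X (x (fst j) \<omega>)) (Pair (x (fst j) \<omega>) -` C j))
      = (\<Prod>n<m. ennreal (pmf (types_pmf (x n \<omega>)) (ws n)))" for \<omega>
  proof -
    have "(\<Prod>i<l. emeasure (X z) (Pair z -` C (n, i))) =
        ennreal (prod_list (map (\<lambda>b. measure (X z) {u. \<tau> (z + u) = b}) (ws n)))" if "n < m" for n z
    proof -
      interpret K: prob_space "X z" by (rule prob_kernels)
      have "emeasure (X z) UNIV = 1" using K.emeasure_space_1 sets_eq_imp_space_eq[OF prob_kernels(4)[of z]] by simp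
      then have "(\<Prod>i<l. emeasure (X z) (Pair z -` C (n, i))) =
        (\<Prod>i<length (ws n). emeasure (X z) {u. \<tau> (z + u) = ws n ! i})"
        using l[OF that] by (intro prod.mono_neutral_cong_right) (auto simp: C_def)
      also have "\<dots> = ennreal (\<Prod>i<length (ws n). measure (X z) {u. \<tau> (z + u) = ws n ! i})"
        by (simp add: K.emeasure_eq_measure prod_ennreal)
      also have "(\<Prod>i<length (ws n). measure (X z) {u. \<tau> (z + u) = ws n ! i})
          = prod_list (map (\<lambda>b. measure (X z) {u. \<tau> (z + u) = b}) (ws n))"
        by (simp add: prod.list_conv_set_nth atLeast0LessThan)
      finally show ?thesis .
    qed
    moreover have "emeasure (N z) {d} = ennreal (measure (N z) {d})" for z d
      using prob_kernels(1)[of z] by (simp add: prob_space_def finite_measure.emeasure_eq_measure)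
    moreover have "(\<Prod>j\<in>{..<m} \<times> {..<l}. emeasure (X (x (fst j) \<omega>)) (Pair (x (fst j) \<omega>) -` C j))
        = (\<Prod>n<m. \<Prod>i<l. emeasure (X (x n \<omega>)) (Pair (x n \<omega>) -` C (n, i)))"
      by (simp add: prod.cartesian_product split_beta')
    moreover have "pmf (types_pmf z) (ws n) =
        measure (N z) {length (ws n)} * prod_list (map (\<lambda>b. measure (X z) {u. \<tau> (z + u) = b}) (ws n))" for z n
      unfolding types_pmf_def pmf_list_pmf pmf_replicas pmf_type ..
    moreover have "0 \<le> prod_list (map (\<lambda>b. measure (X z) {u. \<tau> (z + u) = b}) bs)" for z bs
      by (rule prod_list_nonneg) auto
    ultimately show ?thesis
      by (simp add: prod.distrib[symmetric] ennreal_mult)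
  qed
  ultimately show ?thesis
    using emeasure_marks_joint[where G = G and m = m and C = C and D = "\<lambda>n. {length (ws n)}" and l = l, OF G C]
    by (simp add: mult.assoc)
qed

text \<open>Replaces a measure that varies with \<open>\<omega>\<close> by counting measure with a
  density varying with \<open>\<omega>\<close>. In this form measurability in
  \<open>\<omega>\<close> and the exchange of integrals are available.\<close>

lemma nn_integral_product_list_pmf_conv:
  "(\<integral>\<^sup>+ls. F ls \<partial>product_list_pmf (map (\<lambda>n. types_pmf (x n \<omega>)) [0..<m])) =
   (\<integral>\<^sup>+ls. F ls * (if length ls = m then \<Prod>n<m. ennreal (pmf (types_pmf (x n \<omega>)) (ls ! n)) else 0) \<partial>count_space UNIV)"
  unfolding nn_integral_measure_pmf
  by (intro nn_integral_cong) (simp add: pmf_product_list_pmf prod_ennreal mult.commute)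

lemma measurable_nn_integral_product_list_pmf [measurable]:
  "(\<lambda>\<omega>. \<integral>\<^sup>+ls. F ls \<partial>product_list_pmf (map (\<lambda>n. types_pmf (x n \<omega>)) [0..<m])) \<in> borel_measurable M"
proof -
  interpret C: sigma_finite_measure "count_space (UNIV :: 'b list list set)"
    by (rule sigma_finite_measure_count_space_countable) simp
  have "(\<lambda>(ls, \<omega>). F ls * (if length ls = m then \<Prod>n<m. ennreal (pmf (types_pmf (x n \<omega>)) (ls ! n)) else 0))
      \<in> borel_measurable (count_space UNIV \<Otimes>\<^sub>M M)"
    by (rule measurable_pair_measure_countable1) simp_all
  from measurable_pair_swap[OF this] show ?thesis
    unfolding nn_integral_product_list_pmf_conv
    by (intro C.borel_measurable_nn_integral) simp
qed

text \<open>The lists of types take countably many values, so the integral is a sum over values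
  weighted by the probabilities from \<open>emeasure_types\<close>; exchanging sum and integral once
  before and once after inserting them yields the averaged form.\<close>

lemma nn_integral_types_event:
  assumes G: "G \<in> sets \<F>" "\<And>\<omega>. \<omega> \<in> G \<Longrightarrow> of_nat m \<le> emeasure (\<Phi> \<omega>) UNIV"
  shows "(\<integral>\<^sup>+\<omega>. indicator G \<omega> * F (map (\<lambda>n. types n \<omega>) [0..<m]) \<partial>M) =
    (\<integral>\<^sup>+\<omega>. indicator G \<omega> * (\<integral>\<^sup>+ls. F ls \<partial>product_list_pmf (map (\<lambda>n. types_pmf (x n \<omega>)) [0..<m])) \<partial>M)"
proof -
  have GM [measurable]: "G \<in> sets M" using G(1) by (rule sets_\<F>)
  let ?E = "\<lambda>ls. {\<omega>\<in>G. map (\<lambda>n. types n \<omega>) [0..<m] = ls}"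
  have E: "?E ls = (if length ls = m then {\<omega>\<in>G. \<forall>n<m. types n \<omega> = ls ! n} else {})" for ls
    by (auto simp: list_eq_iff_nth_eq)
  have [measurable]: "?E ls \<in> sets M" for ls
  proof -
    have "{\<omega>\<in>G. \<forall>n<m. types n \<omega> = ls ! n} = G \<inter> {\<omega>\<in>space M. \<forall>n<m. types n \<omega> = ls ! n}"
      using sets.sets_into_space[OF GM] by auto
    then show ?thesis unfolding E by simp
  qed
  have "(\<integral>\<^sup>+\<omega>. indicator G \<omega> * F (map (\<lambda>n. types n \<omega>) [0..<m]) \<partial>M) =
    (\<integral>\<^sup>+\<omega>. \<integral>\<^sup>+ls. F ls * indicator (?E ls) \<omega> \<partial>count_space UNIV \<partial>M)"
  proof (rule nn_integral_cong)
    fix \<omega>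
    let ?l = "map (\<lambda>n. types n \<omega>) [0..<m]"
    have "(\<integral>\<^sup>+ls. F ls * indicator (?E ls) \<omega> \<partial>count_space UNIV) =
      (\<integral>\<^sup>+ls. (indicator G \<omega> * F ?l) * indicator {?l} ls \<partial>count_space UNIV)"
      by (intro nn_integral_cong) (auto split: split_indicator)
    then show "indicator G \<omega> * F ?l = (\<integral>\<^sup>+ls. F ls * indicator (?E ls) \<omega> \<partial>count_space UNIV)"
      by (simp add: nn_integral_cmult_indicator)
  qed
  also have "\<dots> = (\<integral>\<^sup>+ls. \<integral>\<^sup>+\<omega>. F ls * indicator (?E ls) \<omega> \<partial>M \<partial>count_space UNIV)"
    by (rule nn_integral_count_space_nn_integral) simp_all
  also have "\<dots> = (\<integral>\<^sup>+ls. F ls * emeasure M (?E ls) \<partial>count_space UNIV)"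
    by (simp add: nn_integral_cmult_indicator)
  also have "\<dots> = (\<integral>\<^sup>+ls. \<integral>\<^sup>+\<omega>. F ls * (indicator G \<omega> *
      (if length ls = m then \<Prod>n<m. ennreal (pmf (types_pmf (x n \<omega>)) (ls ! n)) else 0)) \<partial>M \<partial>count_space UNIV)"
  proof (rule nn_integral_cong)
    fix ls
    show "F ls * emeasure M (?E ls) = (\<integral>\<^sup>+\<omega>. F ls * (indicator G \<omega> *
      (if length ls = m then \<Prod>n<m. ennreal (pmf (types_pmf (x n \<omega>)) (ls ! n)) else 0)) \<partial>M)"
      using emeasure_types[OF G, of "\<lambda>n. ls ! n"] unfolding E
      by (cases "length ls = m") (simp_all add: nn_integral_cmult)
  qed
  also have "\<dots> = (\<integral>\<^sup>+\<omega>. \<integral>\<^sup>+ls. indicator G \<omega> * (F ls *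
      (if length ls = m then \<Prod>n<m. ennreal (pmf (types_pmf (x n \<omega>)) (ls ! n)) else 0)) \<partial>count_space UNIV \<partial>M)"
    by (subst nn_integral_count_space_nn_integral[symmetric]) (simp_all add: mult.left_commute)
  also have "\<dots> = (\<integral>\<^sup>+\<omega>. indicator G \<omega> * (\<integral>\<^sup>+ls. F ls \<partial>product_list_pmf (map (\<lambda>n. types_pmf (x n \<omega>)) [0..<m])) \<partial>M)"
    unfolding nn_integral_product_list_pmf_conv by (simp add: nn_integral_cmult)
  finally show ?thesis .
qed

end

section \<open>Enumerations of the points\<close>

text \<open>A truncation that is meaningful for finite and infinite configurations alike; a list
  rather than a set, so that multiple points keep their multiplicity.\<close>

definition points :: "(nat \<Rightarrow> 'a measure \<Rightarrow> 'a::euclidean_space) \<Rightarrow> nat \<Rightarrow> 'a measure \<Rightarrow> 'a list" where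
  "points \<xi> m \<mu> = map (\<lambda>n. \<xi> n \<mu>) (filter (\<lambda>n. of_nat n < emeasure \<mu> UNIV) [0..<m])"

lemma sum_list_points:
  fixes g :: "'a::euclidean_space \<Rightarrow> 'b::comm_monoid_add"
  shows "(\<Sum>z\<leftarrow>points \<xi> m \<mu>. g z) = (\<Sum>n<m. if of_nat n < emeasure \<mu> UNIV then g (\<xi> n \<mu>) else 0)"
  by (induction m) (simp_all add: points_def)

lemma mset_points_mono: "m \<le> m' \<Longrightarrow> mset (points \<xi> m \<mu>) \<subseteq># mset (points \<xi> m' \<mu>)"
  by (metis (no_types, lifting) points_def filter_append map_append mset_append mset_subset_eq_add_left
      le_Suc_ex upt_add_eq_append zero_le)

lemma emeasure_points:
  assumes "point_enumeration \<xi>" "\<mu> \<in> space counting_measures" "B \<in> sets borel"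
  shows "emeasure \<mu> B = (SUP m. of_nat (size (filter_mset (\<lambda>z. z \<in> B) (mset (points \<xi> m \<mu>)))))"
proof -
  have "of_nat (size (filter_mset (\<lambda>z. z \<in> B) (mset zs))) = (\<Sum>z\<leftarrow>zs. indicator B z :: ennreal)" for zs
    by (induction zs) auto
  then show ?thesis
    using assms unfolding point_enumeration_def
    by (simp add: sum_list_points suminf_eq_SUP if_distrib cong: if_cong)
qed

text \<open>A natural number below \<open>c\<close> is at most \<open>c - 1\<close>, so a supremum
  of natural numbers cannot reach a positive \<open>c\<close> unless one of them does.\<close>

lemma of_nat_le_SUP_iff:
  "of_nat c \<le> (SUP m. of_nat (f m) :: ennreal) \<longleftrightarrow> (c = 0 \<or> (\<exists>m. c \<le> f m))"
proof
  assume le: "of_nat c \<le> (SUP m. of_nat (f m) :: ennreal)"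
  show "c = 0 \<or> (\<exists>m. c \<le> f m)"
  proof (rule ccontr)
    assume "\<not> (c = 0 \<or> (\<exists>m. c \<le> f m))"
    then have "c \<noteq> 0" "\<And>m. f m \<le> c - 1" by (auto simp: not_le) (metis Suc_pred less_Suc_eq_le)
    then have "(SUP m. of_nat (f m) :: ennreal) \<le> of_nat (c - 1)" by (intro SUP_least) simp
    also have "\<dots> < of_nat c" using \<open>c \<noteq> 0\<close> by simp
    finally show False using le by simp
  qed
next
  show "c = 0 \<or> (\<exists>m. c \<le> f m) \<Longrightarrow> of_nat c \<le> (SUP m. of_nat (f m) :: ennreal)"
    by (auto intro: SUP_upper2)
qed

text \<open>Two perturbations of the same process may come with different enumerations of its points.\<close>

lemma mset_points_enumerations:
  assumes \<xi>: "point_enumeration \<xi>" and \<xi>': "point_enumeration \<xi>'" and \<mu>: "\<mu> \<in> space counting_measures"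
  obtains m' where "mset (points \<xi> m \<mu>) \<subseteq># mset (points \<xi>' m' \<mu>)"
proof -
  let ?c = "\<lambda>\<xi> m z. count (mset (points \<xi> m \<mu>)) z"
  \<comment> \<open>The multiplicities of \<open>z\<close> in the truncations increase to the mass
    of the atom \<open>z\<close>, whichever enumeration is used; this is the link between the
    two.\<close>
  have em: "emeasure \<mu> {z} = (SUP m. of_nat (?c \<zeta> m z))" if "point_enumeration \<zeta>" for z \<zeta>
    using emeasure_points[OF that \<mu>, of "{z}"] by (simp add: filter_eq_replicate_mset)
  have "\<exists>m'. ?c \<xi> m z \<le> ?c \<xi>' m' z" for z
  proof -
    have "of_nat (?c \<xi> m z) \<le> (SUP m. of_nat (?c \<xi>' m z) :: ennreal)"
      unfolding em[OF \<xi>', symmetric] em[OF \<xi>] by (rule SUP_upper) simp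
    then show ?thesis unfolding of_nat_le_SUP_iff by (metis zero_le)
  qed
  then obtain r where r: "\<And>z. ?c \<xi> m z \<le> ?c \<xi>' (r z) z" by metis
  \<comment> \<open>Only finitely many points occur in the given truncation, so the largest of their
    thresholds works for all; \<open>insert 0\<close> covers the empty truncation.\<close>
  define m' where "m' = Max (insert 0 (r ` set (points \<xi> m \<mu>)))"
  have "?c \<xi> m z \<le> ?c \<xi>' m' z" for z
  proof (cases "z \<in> set (points \<xi> m \<mu>)")
    case True
    then have "r z \<le> m'" unfolding m'_def by (intro Max_ge) auto
    then show ?thesis using r[of z] mset_points_mono[of "r z" m' \<xi>' \<mu>]
      by (metis mset_subset_eq_count order_trans)
  next
    case False
    then have "?c \<xi> m z = 0" unfolding count_eq_zero_iff by simp
    then show ?thesis by linarith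
  qed
  then show ?thesis using that[of m'] by (simp add: subseteq_mset_def)
qed

text \<open>Campbell's formula. For an indicator both sides are the expected number of points in the
  set; multiples, sums and increasing limits follow by linearity and monotone convergence.\<close>

lemma campbell_formula:
  fixes \<Phi> :: "'w \<Rightarrow> 'a::euclidean_space measure"
  assumes pp: "point_process M \<Phi>" and \<xi>: "point_enumeration \<xi>" and g: "g \<in> borel_measurable borel"
  shows "(\<integral>\<^sup>+z. g z \<partial>mean_measure M \<Phi>) =
    (\<integral>\<^sup>+\<omega>. (\<Sum>n. if of_nat n < emeasure (\<Phi> \<omega>) UNIV then g (\<xi> n (\<Phi> \<omega>)) else 0) \<partial>M)"
proof -
  have \<Phi> [measurable]: "\<Phi> \<in> M \<rightarrow>\<^sub>M counting_measures" using pp by (simp add: point_process_def)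
  have [measurable]: "\<xi> n \<in> counting_measures \<rightarrow>\<^sub>M borel" for n using \<xi> by (simp add: point_enumeration_def)
  have [measurable]: "(\<lambda>\<omega>. emeasure (\<Phi> \<omega>) UNIV) \<in> borel_measurable M"
    by (rule measurable_compose[OF \<Phi> measurable_emeasure_counting_measures]) simp
  have s [measurable_cong]: "sets (mean_measure M \<Phi>) = sets borel"
    using sets.sigma_sets_eq[of "borel :: 'a measure"] by (simp add: mean_measure_def)
  show ?thesis using g
  proof (induction rule: borel_measurable_induct)
    case (cong f g)
    then have "f = g" by (intro ext) simp
    from cong show ?case unfolding \<open>f = g\<close> by - assumption
  next
    case (set A)
    have "(\<integral>\<^sup>+\<omega>. emeasure (\<Phi> \<omega>) A \<partial>M) = (\<integral>\<^sup>+\<omega>. (\<Sum>n. if of_nat n < emeasure (\<Phi> \<omega>) UNIV then indicator A (\<xi> n (\<Phi> \<omega>)) else 0) \<partial>M)"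
      using \<xi> set measurable_space[OF \<Phi>] by (intro nn_integral_cong) (simp add: point_enumeration_def)
    then show ?case using emeasure_mean_measure[OF pp set] set by (simp add: s)
  next
    case (mult u c)
    have "(\<Sum>n. if of_nat n < emeasure (\<Phi> \<omega>) UNIV then c * u (\<xi> n (\<Phi> \<omega>)) else 0)
        = c * (\<Sum>n. if of_nat n < emeasure (\<Phi> \<omega>) UNIV then u (\<xi> n (\<Phi> \<omega>)) else 0)" for \<omega>
      unfolding ennreal_suminf_cmult[symmetric] by (intro suminf_cong) simp
    then show ?case using mult by (simp add: nn_integral_cmult)
  next
    case (add u v)
    have "(\<Sum>n. if of_nat n < emeasure (\<Phi> \<omega>) UNIV then v (\<xi> n (\<Phi> \<omega>)) + u (\<xi> n (\<Phi> \<omega>)) else 0)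
        = (\<Sum>n. if of_nat n < emeasure (\<Phi> \<omega>) UNIV then v (\<xi> n (\<Phi> \<omega>)) else 0)
        + (\<Sum>n. if of_nat n < emeasure (\<Phi> \<omega>) UNIV then u (\<xi> n (\<Phi> \<omega>)) else 0)" for \<omega>
      by (subst suminf_add) (auto intro!: suminf_cong)
    then show ?case using add by (simp add: nn_integral_add)
  next
    case (seq U)
    have [measurable]: "U i \<in> borel_measurable borel" for i by (rule seq)
    have inc: "incseq (\<lambda>i. if of_nat n < emeasure (\<Phi> \<omega>) UNIV then U i (\<xi> n (\<Phi> \<omega>)) else 0)" for n \<omega>
      using seq(3) by (auto simp: incseq_def le_fun_def)
    have U: "(SUP i. U i) = (\<lambda>z. SUP i. U i z)" by (auto simp: fun_eq_iff image_comp)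
    have "(\<integral>\<^sup>+z. (SUP i. U i) z \<partial>mean_measure M \<Phi>) = (SUP i. \<integral>\<^sup>+z. U i z \<partial>mean_measure M \<Phi>)"
      unfolding U using seq(3) by (intro nn_integral_monotone_convergence_SUP) auto
    also have "\<dots> = (SUP i. \<integral>\<^sup>+\<omega>. (\<Sum>n. if of_nat n < emeasure (\<Phi> \<omega>) UNIV then U i (\<xi> n (\<Phi> \<omega>)) else 0) \<partial>M)"
      using seq by simp
    also have "\<dots> = (\<integral>\<^sup>+\<omega>. (SUP i. \<Sum>n. if of_nat n < emeasure (\<Phi> \<omega>) UNIV then U i (\<xi> n (\<Phi> \<omega>)) else 0) \<partial>M)"
    proof (rule nn_integral_monotone_convergence_SUP[symmetric])
      show "incseq (\<lambda>i \<omega>. \<Sum>n. if of_nat n < emeasure (\<Phi> \<omega>) UNIV then U i (\<xi> n (\<Phi> \<omega>)) else 0)"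
        using seq(3) by (intro incseq_SucI le_funI suminf_le) (auto simp: incseq_def le_fun_def)
    qed measurable
    also have "\<dots> = (\<integral>\<^sup>+\<omega>. (\<Sum>n. if of_nat n < emeasure (\<Phi> \<omega>) UNIV then (SUP i. U i) (\<xi> n (\<Phi> \<omega>)) else 0) \<partial>M)"
      by (subst ennreal_suminf_SUP_eq[symmetric]) (auto simp: inc image_comp intro!: nn_integral_cong suminf_cong)
    finally show ?case .
  qed
qed

section \<open>Law of the types contributed by the first points\<close>

context typed_marked_process
begin

text \<open>These multisets increase with \<open>m\<close>. They stand in for the perturbed process,
  whose counts in the sets of interest are their limits.\<close>

definition seen :: "nat \<Rightarrow> 'w \<Rightarrow> 'b multiset" where
  "seen m \<omega> = mset (concat (map (\<lambda>n. types n \<omega>) (filter (\<lambda>n. of_nat n < emeasure (\<Phi> \<omega>) UNIV) [0..<m])))"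

lemma filter_points: "filter (\<lambda>n. of_nat n < (c :: ennreal)) [0..<m]
    = [0..<length (filter (\<lambda>n. of_nat n < c) [0..<m])]"
proof (induction m)
  case (Suc m)
  have "filter (\<lambda>n. of_nat n < c) [0..<m] = [0..<m]" if "of_nat m < c"
  proof (rule filter_True, rule ballI)
    fix n assume "n \<in> set [0..<m]"
    then have "of_nat n \<le> (of_nat m :: ennreal)" by simp
    then show "of_nat n < c" using that by (rule le_less_trans)
  qed
  then show ?case using Suc by auto
qed simp

text \<open>The existing indices form an initial segment, so their number \<open>p\<close>
  determines the truncated list. On this event, which belongs to \<open>\<F>\<close>, at least
  \<open>p\<close> points exist and the law of the first \<open>p\<close> marks applies.\<close>

definition count_event :: "nat \<Rightarrow> nat \<Rightarrow> 'w set" where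
  "count_event m p = {\<omega>\<in>space M. length (filter (\<lambda>n. of_nat n < emeasure (\<Phi> \<omega>) UNIV) [0..<m]) = p}"

lemma sets_count_event: "count_event m p \<in> sets \<F>"
proof -
  have [measurable]: "(\<lambda>\<omega>. emeasure (\<Phi> \<omega>) UNIV) \<in> borel_measurable \<F>"
    by (rule measurable_compose[OF measurable_\<F> measurable_emeasure_counting_measures]) simp
  have "(\<lambda>\<omega>. length (filter (\<lambda>n. of_nat n < emeasure (\<Phi> \<omega>) UNIV) [0..<m])) \<in> \<F> \<rightarrow>\<^sub>M count_space UNIV"
  proof (induction m)
    case (Suc m)
    have "(\<lambda>\<omega>. length (filter (\<lambda>n. of_nat n < emeasure (\<Phi> \<omega>) UNIV) [0..<m]) +
        (if of_nat m < emeasure (\<Phi> \<omega>) UNIV then 1 else 0)) \<in> \<F> \<rightarrow>\<^sub>M count_space UNIV"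
      using Suc by measurable
    also have "(\<lambda>\<omega>. length (filter (\<lambda>n. of_nat n < emeasure (\<Phi> \<omega>) UNIV) [0..<m]) +
        (if of_nat m < emeasure (\<Phi> \<omega>) UNIV then 1 else 0))
      = (\<lambda>\<omega>. length (filter (\<lambda>n. of_nat n < emeasure (\<Phi> \<omega>) UNIV) [0..<Suc m]))"
      by auto
    finally show ?case .
  qed simp
  from measurable_sets[OF this, of "{p}"] show ?thesis
    by (simp add: count_event_def vimage_def Int_def conj_commute)
qed

lemma count_event_le:
  assumes "\<omega> \<in> count_event m p"
  shows "of_nat p \<le> emeasure (\<Phi> \<omega>) UNIV"
proof -
  have "\<Phi> \<omega> \<in> space counting_measures"
    using assms measurable_space[OF measurable_process] by (auto simp: count_event_def)
  moreover have "p = length (points \<xi> m (\<Phi> \<omega>))" using assms by (simp add: count_event_def points_def)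
  ultimately show ?thesis
    using emeasure_points[OF enum, of "\<Phi> \<omega>" UNIV] by (auto intro!: SUP_upper2[of m])
qed

lemma sum_count_event:
  fixes f :: "'w \<Rightarrow> ennreal"
  assumes "\<omega> \<in> space M"
  shows "f \<omega> = (\<Sum>p\<le>m. indicator (count_event m p) \<omega> * f \<omega>)"
proof -
  let ?p = "length (filter (\<lambda>n. of_nat n < emeasure (\<Phi> \<omega>) UNIV) [0..<m])"
  have "?p \<le> m" using length_filter_le[of _ "[0..<m]"] by simp
  then have "(\<Sum>p\<le>m. indicator (count_event m p) \<omega> * f \<omega>) = (\<Sum>p\<in>{?p}. indicator (count_event m p) \<omega> * f \<omega>)"
    using assms by (intro sum.mono_neutral_right) (auto simp: count_event_def)
  also have "\<dots> = f \<omega>" using assms by (simp add: count_event_def)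
  finally show ?thesis by simp
qed

lemma measurable_types_list [measurable]:
  "(\<lambda>\<omega>. map (\<lambda>n. types n \<omega>) [0..<p]) \<in> M \<rightarrow>\<^sub>M count_space UNIV"
proof (rule measurable_count_space_eq_countable[THEN iffD2, OF _ conjI])
  show "\<forall>ls\<in>UNIV. (\<lambda>\<omega>. map (\<lambda>n. types n \<omega>) [0..<p]) -` {ls} \<inter> space M \<in> sets M"
  proof
    fix ls :: "'b list list"
    have "map (\<lambda>n. types n \<omega>) [0..<p] = ls \<longleftrightarrow> length ls = p \<and> (\<forall>n<p. types n \<omega> = ls ! n)" for \<omega>
      by (auto simp: list_eq_iff_nth_eq)
    then have "(\<lambda>\<omega>. map (\<lambda>n. types n \<omega>) [0..<p]) -` {ls} \<inter> space M
        = (if length ls = p then {\<omega>\<in>space M. \<forall>n<p. types n \<omega> = ls ! n} else {})"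
      by (simp add: vimage_def Int_def conj_commute)
    also have "\<dots> \<in> sets M" by simp
    finally show "(\<lambda>\<omega>. map (\<lambda>n. types n \<omega>) [0..<p]) -` {ls} \<inter> space M \<in> sets M" .
  qed
qed simp_all

text \<open>All three claims come from splitting according to the number \<open>p\<close> of
  existing points among the first \<open>m\<close> indices. On each piece the index list is the
  fixed list \<open>[0..<p]\<close>, and \<open>nn_integral_types_event\<close> applies.\<close>

lemma
  fixes H :: "'b multiset \<Rightarrow> ennreal"
  shows measurable_seen: "(\<lambda>\<omega>. H (seen m \<omega>)) \<in> borel_measurable M" (is "?f \<in> _")
    and measurable_superposition:
      "(\<lambda>\<omega>. \<integral>\<^sup>+A. H A \<partial>superposition_pmf (map types_pmf (points \<xi> m (\<Phi> \<omega>)))) \<in> borel_measurable M" (is "?g \<in> _")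
    and nn_integral_seen: "(\<integral>\<^sup>+\<omega>. H (seen m \<omega>) \<partial>M) =
      (\<integral>\<^sup>+\<omega>. \<integral>\<^sup>+A. H A \<partial>superposition_pmf (map types_pmf (points \<xi> m (\<Phi> \<omega>))) \<partial>M)"
proof -
  have [measurable]: "count_event m p \<in> sets M" for p by (rule sets_\<F>[OF sets_count_event])
  have p: "filter (\<lambda>n. of_nat n < emeasure (\<Phi> \<omega>) UNIV) [0..<m] = [0..<p]" if "\<omega> \<in> count_event m p" for \<omega> p
    using that filter_points[of "emeasure (\<Phi> \<omega>) UNIV" m] by (simp add: count_event_def)
  let ?F = "\<lambda>p \<omega>. H (mset (concat (map (\<lambda>n. types n \<omega>) [0..<p])))"
  let ?G = "\<lambda>p \<omega>. \<integral>\<^sup>+ls. H (mset (concat ls)) \<partial>product_list_pmf (map (\<lambda>n. types_pmf (x n \<omega>)) [0..<p])"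
  have f: "?f \<omega> = (\<Sum>p\<le>m. indicator (count_event m p) \<omega> * ?F p \<omega>)" if "\<omega> \<in> space M" for \<omega>
    by (subst sum_count_event[OF that, of ?f m], rule sum.cong) (auto simp: seen_def p split: split_indicator)
  have g: "?g \<omega> = (\<Sum>p\<le>m. indicator (count_event m p) \<omega> * ?G p \<omega>)" if "\<omega> \<in> space M" for \<omega>
    by (subst sum_count_event[OF that, of ?g m], rule sum.cong)
      (auto simp: points_def superposition_pmf_def comp_def p split: split_indicator)
  have [measurable]: "?F p \<in> borel_measurable M" for p
    by (rule measurable_compose[OF measurable_types_list[of p], of "\<lambda>ls. H (mset (concat ls))"]) simp
  show "?f \<in> borel_measurable M" by (rule measurable_cong[THEN iffD2, OF f]) measurable
  show "?g \<in> borel_measurable M" by (rule measurable_cong[THEN iffD2, OF g]) measurable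
  have "(\<integral>\<^sup>+\<omega>. ?f \<omega> \<partial>M) = (\<integral>\<^sup>+\<omega>. (\<Sum>p\<le>m. indicator (count_event m p) \<omega> * ?F p \<omega>) \<partial>M)"
    by (rule nn_integral_cong[OF f])
  also have "\<dots> = (\<Sum>p\<le>m. \<integral>\<^sup>+\<omega>. indicator (count_event m p) \<omega> * ?F p \<omega> \<partial>M)"
    by (rule nn_integral_sum) measurable
  also have "\<dots> = (\<Sum>p\<le>m. \<integral>\<^sup>+\<omega>. indicator (count_event m p) \<omega> * ?G p \<omega> \<partial>M)"
    using nn_integral_types_event[OF sets_count_event count_event_le, of m, where F = "\<lambda>ls. H (mset (concat ls))"]
    by (intro sum.cong) auto
  also have "\<dots> = (\<integral>\<^sup>+\<omega>. (\<Sum>p\<le>m. indicator (count_event m p) \<omega> * ?G p \<omega>) \<partial>M)"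
    by (rule nn_integral_sum[symmetric]) measurable
  also have "\<dots> = (\<integral>\<^sup>+\<omega>. ?g \<omega> \<partial>M)"
    by (rule nn_integral_cong[OF g[symmetric]])
  finally show "(\<integral>\<^sup>+\<omega>. ?f \<omega> \<partial>M) = (\<integral>\<^sup>+\<omega>. ?g \<omega> \<partial>M)" .
qed

lemma mset_seen_mono: "m \<le> m' \<Longrightarrow> seen m \<omega> \<subseteq># seen m' \<omega>"
  unfolding seen_def
  by (metis (no_types, lifting) concat_append filter_append map_append mset_append mset_subset_eq_add_left
      le_Suc_ex upt_add_eq_append zero_le)

text \<open>Monotone convergence is used on both sides: the types seen increase with
  \<open>m\<close>, and so do the averages, because a longer truncation superposes more
  points.\<close>

lemma nn_integral_SUP_seen:
  assumes H: "\<And>A B. H A \<le> H (A + B)"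
  shows "(\<integral>\<^sup>+\<omega>. (SUP m. H (seen m \<omega>)) \<partial>M) =
    (\<integral>\<^sup>+\<omega>. (SUP m. \<integral>\<^sup>+A. H A \<partial>superposition_pmf (map types_pmf (points \<xi> m (\<Phi> \<omega>)))) \<partial>M)"
proof -
  have H': "H A \<le> H B" if "A \<subseteq># B" for A B
    using H[of A "B - A"] that by simp
  have "(\<integral>\<^sup>+\<omega>. (SUP m. H (seen m \<omega>)) \<partial>M) = (SUP m. \<integral>\<^sup>+\<omega>. H (seen m \<omega>) \<partial>M)"
    by (intro nn_integral_monotone_convergence_SUP measurable_seen)
      (auto simp: incseq_def le_fun_def intro!: H' mset_seen_mono)
  also have "\<dots> = (\<integral>\<^sup>+\<omega>. (SUP m. \<integral>\<^sup>+A. H A \<partial>superposition_pmf (map types_pmf (points \<xi> m (\<Phi> \<omega>)))) \<partial>M)"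
    unfolding nn_integral_seen
    by (intro nn_integral_monotone_convergence_SUP[symmetric] measurable_superposition)
      (auto simp: incseq_def le_fun_def mset_map intro!: superposition_pmf_mono_mset H image_mset_subseteq_mono mset_points_mono)
  finally show ?thesis .
qed

end

text \<open>The kernels are compared along one enumeration, \<open>\<xi>\<^sub>1\<close>, for both
  of them; the passage to \<open>\<xi>\<^sub>2\<close> is made afterwards, with the second kernel
  fixed, by embedding each truncation into a sufficiently long one of the other enumeration.\<close>

lemma nn_integral_SUP_seen_mono:
  fixes \<tau> :: "'a::euclidean_space \<Rightarrow> 'b::countable"
  assumes 1: "typed_marked_process M \<Phi> N\<^sub>1 X \<xi>\<^sub>1 \<nu>\<^sub>1 y\<^sub>1 \<tau>" and 2: "typed_marked_process M \<Phi> N\<^sub>2 X \<xi>\<^sub>2 \<nu>\<^sub>2 y\<^sub>2 \<tau>"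
    and H: "\<And>A B. H A \<le> H (A + B)"
    and le: "AE \<omega> in M. \<forall>m.
      (\<integral>\<^sup>+A. H A \<partial>superposition_pmf (map (typed_marked_process.types_pmf N\<^sub>1 X \<tau>) (points \<xi>\<^sub>1 m (\<Phi> \<omega>))))
      \<le> (\<integral>\<^sup>+A. H A \<partial>superposition_pmf (map (typed_marked_process.types_pmf N\<^sub>2 X \<tau>) (points \<xi>\<^sub>1 m (\<Phi> \<omega>))))"
  shows "(\<integral>\<^sup>+\<omega>. (SUP m. H (typed_marked_process.seen \<Phi> \<xi>\<^sub>1 \<nu>\<^sub>1 y\<^sub>1 \<tau> m \<omega>)) \<partial>M)
      \<le> (\<integral>\<^sup>+\<omega>. (SUP m. H (typed_marked_process.seen \<Phi> \<xi>\<^sub>2 \<nu>\<^sub>2 y\<^sub>2 \<tau> m \<omega>)) \<partial>M)"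
proof -
  interpret A: typed_marked_process M \<Phi> N\<^sub>1 X \<xi>\<^sub>1 \<nu>\<^sub>1 y\<^sub>1 \<tau> by fact
  interpret B: typed_marked_process M \<Phi> N\<^sub>2 X \<xi>\<^sub>2 \<nu>\<^sub>2 y\<^sub>2 \<tau> by fact
  show ?thesis
    unfolding A.nn_integral_SUP_seen[of H, OF H] B.nn_integral_SUP_seen[of H, OF H]
  proof (intro nn_integral_mono_AE, use le AE_space in eventually_elim)
    fix \<omega> assume le: "\<forall>m. (\<integral>\<^sup>+A. H A \<partial>superposition_pmf (map A.types_pmf (points \<xi>\<^sub>1 m (\<Phi> \<omega>))))
      \<le> (\<integral>\<^sup>+A. H A \<partial>superposition_pmf (map B.types_pmf (points \<xi>\<^sub>1 m (\<Phi> \<omega>))))" and \<omega>: "\<omega> \<in> space M"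
    have \<mu>: "\<Phi> \<omega> \<in> space counting_measures" using measurable_space[OF A.measurable_process \<omega>] .
    show "(SUP m. \<integral>\<^sup>+A. H A \<partial>superposition_pmf (map A.types_pmf (points \<xi>\<^sub>1 m (\<Phi> \<omega>))))
      \<le> (SUP m. \<integral>\<^sup>+A. H A \<partial>superposition_pmf (map B.types_pmf (points \<xi>\<^sub>2 m (\<Phi> \<omega>))))"
    proof (rule SUP_least)
      fix m
      obtain m' where m': "mset (points \<xi>\<^sub>1 m (\<Phi> \<omega>)) \<subseteq># mset (points \<xi>\<^sub>2 m' (\<Phi> \<omega>))"
        by (rule mset_points_enumerations[OF A.enum B.enum \<mu>])
      have "(\<integral>\<^sup>+A. H A \<partial>superposition_pmf (map A.types_pmf (points \<xi>\<^sub>1 m (\<Phi> \<omega>))))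
        \<le> (\<integral>\<^sup>+A. H A \<partial>superposition_pmf (map B.types_pmf (points \<xi>\<^sub>1 m (\<Phi> \<omega>))))" using le by blast
      also have "\<dots> \<le> (\<integral>\<^sup>+A. H A \<partial>superposition_pmf (map B.types_pmf (points \<xi>\<^sub>2 m' (\<Phi> \<omega>))))"
        using H by (intro superposition_pmf_mono_mset) (auto simp: mset_map intro!: image_mset_subseteq_mono m')
      also have "\<dots> \<le> (SUP m. \<integral>\<^sup>+A. H A \<partial>superposition_pmf (map B.types_pmf (points \<xi>\<^sub>2 m (\<Phi> \<omega>))))"
        by (rule SUP_upper) simp
      finally show "(\<integral>\<^sup>+A. H A \<partial>superposition_pmf (map A.types_pmf (points \<xi>\<^sub>1 m (\<Phi> \<omega>))))
        \<le> (SUP m. \<integral>\<^sup>+A. H A \<partial>superposition_pmf (map B.types_pmf (points \<xi>\<^sub>2 m (\<Phi> \<omega>))))" .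
    qed
  qed
qed

section \<open>Directionally convex functions of counts\<close>

text \<open>The type of a point \<open>z\<close> lists which of the sets \<open>B r\<close> contain it.  It determines the counts, and
  since types are countable all laws become discrete.\<close>

definition hit_type :: "nat \<Rightarrow> (nat \<Rightarrow> 'a set) \<Rightarrow> 'a \<Rightarrow> bool list" where
  "hit_type k B z = map (\<lambda>r. z \<in> B r) [0..<k]"

definition hit_vector :: "nat \<Rightarrow> bool list multiset \<Rightarrow> nat \<Rightarrow> real" where
  "hit_vector k A = (\<lambda>r\<in>{..<k}. real (size (filter_mset (\<lambda>b. b ! r) A)))"

lemma measurable_hit_type:
  assumes "\<And>r. r < k \<Longrightarrow> B r \<in> sets (borel :: 'a::euclidean_space measure)"
  shows "hit_type k B \<in> borel \<rightarrow>\<^sub>M count_space UNIV"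
proof (rule measurable_count_space_eq_countable[THEN iffD2, OF _ conjI])
  show "\<forall>bs\<in>UNIV. hit_type k B -` {bs} \<inter> space borel \<in> sets borel"
  proof
    fix bs :: "bool list"
    have "hit_type k B z = bs \<longleftrightarrow> length bs = k \<and> (\<forall>r\<in>{..<k}. z \<in> B r \<longleftrightarrow> bs ! r)" for z
      by (auto simp: hit_type_def list_eq_iff_nth_eq)
    then have "hit_type k B -` {bs} \<inter> space borel
        = (if length bs = k then {z\<in>space borel. \<forall>r\<in>{..<k}. z \<in> B r \<longleftrightarrow> bs ! r} else {})"
      by (simp add: vimage_def)
    also have "\<dots> \<in> sets borel"
    proof (cases "length bs = k")
      case True
      have "{z\<in>space borel. z \<in> B r \<longleftrightarrow> bs ! r} \<in> sets borel" if "r < k" for r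
        using assms[OF that] by (cases "bs ! r") (auto simp: Compl_eq[symmetric])
      then have "{z\<in>space borel. \<forall>r\<in>{..<k}. z \<in> B r \<longleftrightarrow> bs ! r} \<in> sets borel"
        by (intro sets.sets_Collect_finite_All) auto
      then show ?thesis using True by simp
    qed simp
    finally show "hit_type k B -` {bs} \<inter> space borel \<in> sets borel" .
  qed
qed simp_all

lemma dcxD:
  assumes "dcx k f" "x \<in> {..<k} \<rightarrow>\<^sub>E UNIV" "y \<in> {..<k} \<rightarrow>\<^sub>E UNIV" "p \<in> {..<k} \<rightarrow>\<^sub>E UNIV" "q \<in> {..<k} \<rightarrow>\<^sub>E UNIV"
    and "\<And>i. i < k \<Longrightarrow> p i \<le> x i \<and> x i \<le> q i \<and> p i \<le> y i \<and> y i \<le> q i \<and> x i + y i = p i + q i"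
  shows "f x + f y \<le> f p + f q"
  using assms unfolding dcx_def by blast

text \<open>Counts are additive and nonnegative, so the four vectors are exactly a configuration to
  which the \<open>dcx\<close> inequality applies.\<close>

lemma dcx_hit_vector:
  assumes "dcx k f"
  shows "f (hit_vector k (A + B)) + f (hit_vector k (A + C)) \<le> f (hit_vector k A) + f (hit_vector k (A + B + C))"
proof -
  have mem: "hit_vector k D \<in> {..<k} \<rightarrow>\<^sub>E UNIV" for D by (auto simp: hit_vector_def)
  show ?thesis
    by (rule dcxD[OF assms mem mem mem mem]) (simp add: hit_vector_def)
qed

text \<open>A single replica may lie in several of the sets and then raises several counts at once,
  so the unit vectors alone do not suffice. Inserting one coordinate is an instance of the
  \<open>dcx\<close> inequality based at the origin.\<close>

lemma dcx_subset_indicator: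
  fixes f :: "(nat \<Rightarrow> real) \<Rightarrow> real"
  assumes "dcx k f" "S \<subseteq> {..<k}"
  defines "e \<equiv> \<lambda>S. (\<lambda>r\<in>{..<k}. of_bool (r \<in> S) :: real)"
  shows "(\<Sum>i\<in>S. f (e {i}) - f (e {})) \<le> f (e S) - f (e {})"
proof -
  have "finite S" using assms(2) finite_subset by blast
  then show ?thesis using assms(2)
  proof (induction S rule: finite_induct)
    case (insert i S)
    have mem: "e D \<in> {..<k} \<rightarrow>\<^sub>E UNIV" for D by (auto simp: e_def)
    have "f (e S) + f (e {i}) \<le> f (e {}) + f (e (insert i S))"
      using insert(2) by (intro dcxD[OF assms(1) mem mem mem mem]) (auto simp: e_def)
    then show ?case using insert by simp
  qed simp
qed

text \<open>Subtracting from a \<open>dcx\<close> function its value and its linear part at the origin of the lattice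
  \<open>\<nat>\<^sup>k\<close> leaves a nonnegative nondecreasing function on that lattice, so that no
  integrability is needed for the comparison of the remainder.\<close>

definition dcx_slope :: "nat \<Rightarrow> ((nat \<Rightarrow> real) \<Rightarrow> real) \<Rightarrow> nat \<Rightarrow> real" where
  "dcx_slope k f i = f (\<lambda>r\<in>{..<k}. of_bool (r = i)) - f (\<lambda>r\<in>{..<k}. 0)"

definition dcx_remainder :: "nat \<Rightarrow> ((nat \<Rightarrow> real) \<Rightarrow> real) \<Rightarrow> (nat \<Rightarrow> real) \<Rightarrow> real" where
  "dcx_remainder k f v = f v - f (\<lambda>r\<in>{..<k}. 0) - (\<Sum>i<k. dcx_slope k f i * v i)"

text \<open>The subtracted part is affine in the counts and cancels from the supermodular
  inequality. The slopes are the increments of \<open>f\<close> along unit vectors, so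
  \<open>dcx_subset_indicator\<close> makes the remainder nonnegative after one replica.\<close>

lemma dcx_remainder_hit_vector:
  assumes "dcx k f"
  defines "h \<equiv> \<lambda>A. dcx_remainder k f (hit_vector k A)"
  shows "h (A + B) + h (A + C) \<le> h A + h (A + B + C)" (is ?super)
    and "h A \<le> h (A + B)" (is ?mono)
    and "0 \<le> h A" (is ?nonneg)
proof -
  have lin: "(\<Sum>i<k. dcx_slope k f i * hit_vector k (A + B) i) =
     (\<Sum>i<k. dcx_slope k f i * hit_vector k A i) + (\<Sum>i<k. dcx_slope k f i * hit_vector k B i)" for A B
    by (simp add: hit_vector_def distrib_left sum.distrib)
  have super: "h (A + B) + h (A + C) \<le> h A + h (A + B + C)" for A B C
    using dcx_hit_vector[OF assms(1), of A B C] by (simp add: h_def dcx_remainder_def lin)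
  have zero: "h {#} = 0" by (simp add: h_def dcx_remainder_def hit_vector_def cong: restrict_cong)
  have single: "0 \<le> h {#b#}" for b
  proof -
    let ?S = "{r\<in>{..<k}. b ! r}"
    have b: "hit_vector k {#b#} = (\<lambda>r\<in>{..<k}. of_bool (r \<in> ?S))"
      by (auto simp: hit_vector_def)
    have "(\<Sum>i<k. dcx_slope k f i * hit_vector k {#b#} i) = (\<Sum>i\<in>?S. dcx_slope k f i)"
      unfolding b by (rule sum.mono_neutral_cong_right) auto
    also have "\<dots> \<le> f (\<lambda>r\<in>{..<k}. of_bool (r \<in> ?S)) - f (\<lambda>r\<in>{..<k}. 0)"
      using dcx_subset_indicator[OF assms(1), of ?S] by (simp add: dcx_slope_def subset_eq)
    finally show ?thesis by (simp add: h_def dcx_remainder_def b)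
  qed
  \<comment> \<open>Supermodularity based at the empty multiset says that a replica raises
    \<open>h\<close> at least as much on top of any configuration as it does alone, and alone it
    does not lower \<open>h\<close>.\<close>
  have mono: "h A \<le> h (A + B)" for A B
  proof (induction B)
    case (add b B)
    have "h {#b#} + h (A + B) \<le> h {#} + h ({#b#} + (A + B))"
      using super[of "{#}" "{#b#}" "A + B"] by simp
    then have "h (A + B) \<le> h (A + add_mset b B)" using single[of b] zero by simp
    with add show ?case by linarith
  qed simp
  show ?super ?mono by (rule super mono)+
  show ?nonneg using mono[of "{#}" A] zero by simp
qed

lemma msupermodular_dcx_remainder:
  assumes "dcx k f"
  shows "msupermodular (\<lambda>A. ennreal (dcx_remainder k f (hit_vector k A)))"
  using dcx_remainder_hit_vector[OF assms]
  by (auto simp: msupermodular_def ennreal_plus[symmetric] simp del: ennreal_plus intro!: ennreal_leI)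

text \<open>Convex order is tested with the functions max (x - j) 0 and with -x, the latter
  reversing the inequality of the means. Finite means make these tests integrable, as the definition
  of \<open>cx_le\<close> demands.\<close>

lemma cx_le_pmf:
  fixes p q :: "nat pmf"
  assumes le: "cx_le (distr (measure_pmf p) borel real) (distr (measure_pmf q) borel real)"
    and fin: "(\<integral>\<^sup>+d. of_nat d \<partial>p) < \<infinity>" "(\<integral>\<^sup>+d. of_nat d \<partial>q) < \<infinity>"
  shows "(\<integral>\<^sup>+d. of_nat (d - j) \<partial>p) \<le> (\<integral>\<^sup>+d. of_nat (d - j) \<partial>q)"
    and "(\<integral>\<^sup>+d. of_nat d \<partial>p) = (\<integral>\<^sup>+d. of_nat d \<partial>q)"
proof -
  have int: "integrable (measure_pmf r) real" if "(\<integral>\<^sup>+d. of_nat d \<partial>r) < \<infinity>" for r :: "nat pmf"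
    using that by (intro integrableI_bounded) (simp_all add: ennreal_of_nat_eq_real_of_nat)
  have intj: "integrable (measure_pmf r) (\<lambda>d. real (d - j))" if "(\<integral>\<^sup>+d. of_nat d \<partial>r) < \<infinity>" for r :: "nat pmf" and j
    by (rule Bochner_Integration.integrable_bound[OF int[OF that]]) auto
  have enn: "(\<integral>\<^sup>+d. of_nat (d - j) \<partial>r) = ennreal (\<integral>d. real (d - j) \<partial>r)" if "(\<integral>\<^sup>+d. of_nat d \<partial>r) < \<infinity>" for r :: "nat pmf" and j
    using nn_integral_eq_integral[OF intj[OF that]] by (simp add: ennreal_of_nat_eq_real_of_nat)
  have le_j: "(\<integral>\<^sup>+d. of_nat (d - j) \<partial>p) \<le> (\<integral>\<^sup>+d. of_nat (d - j) \<partial>q)" for j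
  proof -
    have cvx: "convex_on UNIV (\<lambda>x. max (x - real j) 0)"
    proof (rule convex_onI)
      fix t x y :: real assume t: "0 < t" "t < 1"
      have "(1 - t) * x + t * y - j = (1 - t) * (x - j) + t * (y - j)" by (simp add: algebra_simps)
      also have "\<dots> \<le> (1 - t) * max (x - j) 0 + t * max (y - j) 0"
        using t by (intro add_mono mult_left_mono) auto
      finally show "max ((1 - t) *\<^sub>R x + t *\<^sub>R y - real j) 0 \<le> (1 - t) * max (x - real j) 0 + t * max (y - real j) 0"
        using t by auto
    qed simp
    have m: "max (real d - real j) 0 = real (d - j)" for d by (auto simp: max_def of_nat_diff)
    have "(\<integral>d. real (d - j) \<partial>p) \<le> (\<integral>d. real (d - j) \<partial>q)"
      using le[unfolded cx_le_def, rule_format, of "\<lambda>x. max (x - real j) 0"] cvx intj[OF fin(1)] intj[OF fin(2)]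
      by (simp add: integrable_distr_eq integral_distr m)
    then show ?thesis unfolding enn[OF fin(1)] enn[OF fin(2)] by (rule ennreal_leI)
  qed
  then show "(\<integral>\<^sup>+d. of_nat (d - j) \<partial>p) \<le> (\<integral>\<^sup>+d. of_nat (d - j) \<partial>q)" .
  have "convex_on UNIV (\<lambda>x :: real. - x)" by (rule convex_onI) (simp_all add: algebra_simps)
  then have "(\<integral>d. - real d \<partial>p) \<le> (\<integral>d. - real d \<partial>q)"
    using le[unfolded cx_le_def, rule_format, of "\<lambda>x. - x"] int[OF fin(1)] int[OF fin(2)]
    by (simp add: integrable_distr_eq integral_distr)
  then have "(\<integral>d. real d \<partial>q) \<le> (\<integral>d. real d \<partial>p)" by simp
  then have "(\<integral>\<^sup>+d. of_nat d \<partial>q) \<le> (\<integral>\<^sup>+d. of_nat d \<partial>p)"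
    using enn[OF fin(1), of 0] enn[OF fin(2), of 0] by (simp add: ennreal_leI)
  then show "(\<integral>\<^sup>+d. of_nat d \<partial>p) = (\<integral>\<^sup>+d. of_nat d \<partial>q)"
    using le_j[of 0] by (auto intro: antisym)
qed

section \<open>Replication means and null sets of the mean measure\<close>

lemma (in marked_process) measure_pmf_replicas: "measure_pmf (pmf_of_measure (N z)) = N z"
  by (intro measure_pmf_of_measure) (simp_all add: prob_kernels)

lemma (in marked_process) mean_replication_eq:
  "mean_replication N z = (\<integral>\<^sup>+d. of_nat d \<partial>pmf_of_measure (N z))"
proof -
  let ?p = "pmf_of_measure (N z)"
  have "(\<integral>\<^sup>+d. of_nat d \<partial>?p) = (\<Sum>d. ennreal (pmf ?p d) * of_nat d)"
    by (simp add: nn_integral_measure_pmf nn_integral_count_space_nat)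
  also have "\<dots> = (\<Sum>d. ennreal (pmf ?p (Suc d)) * of_nat (Suc d))"
    using suminf_offset[of "\<lambda>d. ennreal (pmf ?p d) * of_nat d" 1] by simp
  also have "\<dots> = mean_replication N z"
    using emeasure_pmf_single[of ?p] by (simp add: mean_replication_def measure_pmf_replicas mult.commute)
  finally show ?thesis ..
qed

lemma sets_mean_measure: "sets (mean_measure M \<Phi>) = sets borel"
  using sets.sigma_sets_eq[of borel] by (simp add: mean_measure_def)

context marked_process
begin

lemma point_process: "point_process M \<Phi>"
  using measurable_process prob_space_axioms by (simp add: point_process_def)

lemma measurable_mean_replication [measurable]: "mean_replication N \<in> borel_measurable borel"
proof -
  have [measurable]: "(\<lambda>z. emeasure (N z) {d}) \<in> borel_measurable borel" for d
    by (rule measurable_emeasure_kernel[OF measurable_prob_algebraD[OF replication_kernel]]) simp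
  show ?thesis unfolding mean_replication_def[abs_def] by measurable
qed

lemma diff_image: "(\<lambda>a. a - z) ` A = {u. z + u \<in> A}" for A :: "'a set"
  by (auto simp: image_iff algebra_simps)

lemma sets_translate:
  assumes "A \<in> sets (borel :: 'a measure)"
  shows "{u. z + u \<in> A} \<in> sets borel"
proof -
  have "(\<lambda>u. z + u) \<in> borel \<rightarrow>\<^sub>M borel" by measurable
  from measurable_sets[OF this assms] show ?thesis by (simp add: vimage_def)
qed

lemma measurable_translate:
  assumes "A \<in> sets borel"
  shows "(\<lambda>z. emeasure (X z) {u. z + u \<in> A}) \<in> borel_measurable borel"
proof -
  have "(\<lambda>p :: 'a \<times> 'a. fst p + snd p) \<in> borel \<Otimes>\<^sub>M borel \<rightarrow>\<^sub>M borel" by measurable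
  from measurable_sets[OF this assms] have "{p :: 'a \<times> 'a. fst p + snd p \<in> A} \<in> sets (borel \<Otimes>\<^sub>M borel)"
    by (simp add: vimage_def space_pair_measure)
  from measurable_emeasure_section[OF translation_kernel this] show ?thesis by simp
qed

text \<open>By Campbell's formula the expected number of points in a null set of the mean measure is
  zero. This carries hypotheses on the kernels at almost every location over to all points of almost
  every realization.\<close>

lemma AE_points:
  assumes "AE z in mean_measure M \<Phi>. P z"
  shows "AE \<omega> in M. \<forall>m. \<forall>z\<in>set (points \<xi> m (\<Phi> \<omega>)). P z"
proof -
  obtain S where S: "S \<in> null_sets (mean_measure M \<Phi>)" "{z\<in>space (mean_measure M \<Phi>). \<not> P z} \<subseteq> S"
    using assms unfolding eventually_ae_filter by auto
  then have [measurable]: "S \<in> sets borel" by (auto simp: sets_mean_measure)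
  have sp: "space (mean_measure M \<Phi>) = UNIV" using sets_eq_imp_space_eq[OF sets_mean_measure] by simp
  have [measurable]: "(\<lambda>\<omega>. emeasure (\<Phi> \<omega>) UNIV) \<in> borel_measurable M"
    by (rule measurable_compose[OF measurable_process measurable_emeasure_counting_measures]) simp
  have "(\<integral>\<^sup>+\<omega>. (\<Sum>n. if of_nat n < emeasure (\<Phi> \<omega>) UNIV then indicator S (x n \<omega>) else 0) \<partial>M) = 0"
    using campbell_formula[OF point_process enum, of "indicator S"] S by (simp add: sets_mean_measure null_setsD1)
  then have "AE \<omega> in M. (\<Sum>n. if of_nat n < emeasure (\<Phi> \<omega>) UNIV then indicator S (x n \<omega>) else 0) = (0 :: ennreal)"
    by (subst (asm) nn_integral_0_iff_AE) auto
  then show ?thesis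
  proof eventually_elim
    fix \<omega> assume 0: "(\<Sum>n. if of_nat n < emeasure (\<Phi> \<omega>) UNIV then indicator S (x n \<omega>) else 0) = (0 :: ennreal)"
    have "x n \<omega> \<notin> S" if "of_nat n < emeasure (\<Phi> \<omega>) UNIV" for n
    proof
      assume "x n \<omega> \<in> S"
      then have "1 \<le> (\<Sum>n. if of_nat n < emeasure (\<Phi> \<omega>) UNIV then indicator S (x n \<omega>) else 0 :: ennreal)"
        using that sum_le_suminf[OF summableI, of "{n}" "\<lambda>n. if of_nat n < emeasure (\<Phi> \<omega>) UNIV then indicator S (x n \<omega>) else 0 :: ennreal"]
        by auto
      then show False using 0 by simp
    qed
    then show "\<forall>m. \<forall>z\<in>set (points \<xi> m (\<Phi> \<omega>)). P z" using S(2) by (auto simp: points_def sp)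
  qed
qed

text \<open>For almost every \<open>z\<close> the integrand is finite on all balls of integer radius
  at once. If the mean were infinite there, every such ball would have to receive no translated
  mass, yet the balls exhaust the space and \<open>X z\<close> has mass one.\<close>

lemma AE_mean_replication_finite:
  assumes "\<And>A. A \<in> sets borel \<Longrightarrow> bounded A \<Longrightarrow>
      (\<integral>\<^sup>+z. mean_replication N z * emeasure (X z) ((\<lambda>a. a - z) ` A) \<partial>mean_measure M \<Phi>) < \<infinity>"
  shows "AE z in mean_measure M \<Phi>. mean_replication N z < \<infinity>"
proof -
  have "AE z in mean_measure M \<Phi>. mean_replication N z * emeasure (X z) {u. z + u \<in> ball 0 (real r)} \<noteq> \<infinity>" for r
  proof (rule nn_integral_noteq_infinite)
    have [measurable]: "(\<lambda>z. emeasure (X z) {u. z + u \<in> ball 0 (real r)}) \<in> borel_measurable borel"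
      by (rule measurable_translate) simp
    show "(\<lambda>z. mean_replication N z * emeasure (X z) {u. z + u \<in> ball 0 (real r)}) \<in> borel_measurable (mean_measure M \<Phi>)"
      unfolding measurable_cong_sets[OF sets_mean_measure refl] by measurable
    show "(\<integral>\<^sup>+z. mean_replication N z * emeasure (X z) {u. z + u \<in> ball 0 (real r)} \<partial>mean_measure M \<Phi>) \<noteq> \<infinity>"
      using assms[of "ball 0 (real r)"] unfolding diff_image by simp
  qed
  then have "AE z in mean_measure M \<Phi>. \<forall>r. mean_replication N z * emeasure (X z) {u. z + u \<in> ball 0 (real r)} \<noteq> \<infinity>"
    by (simp add: AE_all_countable)
  then show ?thesis
  proof eventually_elim
    fix z assume fin: "\<forall>r. mean_replication N z * emeasure (X z) {u. z + u \<in> ball 0 (real r)} \<noteq> \<infinity>"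
    interpret K: prob_space "X z" by (rule prob_kernels)
    show "mean_replication N z < \<infinity>"
    proof (rule ccontr)
      assume "\<not> mean_replication N z < \<infinity>"
      then have "mean_replication N z = \<top>" by (simp add: less_top[symmetric])
      then have "emeasure (X z) {u. z + u \<in> ball 0 (real r)} = 0" for r
        using fin by (auto simp: ennreal_top_mult split: if_splits)
      moreover have "{u. z + u \<in> ball 0 (real r)} \<in> sets (X z)" for r
        unfolding prob_kernels by (rule sets_translate) simp
      ultimately have "(\<Union>r::nat. {u. z + u \<in> ball 0 (real r)}) \<in> null_sets (X z)"
        by (intro null_sets_UN) auto
      moreover have "(\<Union>r::nat. {u. z + u \<in> ball 0 (real r)}) = space (X z)"
        using sets_eq_imp_space_eq[OF prob_kernels(4)[of z]] reals_Archimedean2 by (auto simp: dist_norm)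
      ultimately show False using K.emeasure_space_1 by auto
    qed
  qed
qed

end

text \<open>Because counts are integers they do not merely converge but become constant, so an
  arbitrary function of the counts can be followed along the truncations without continuity.\<close>

lemma SUP_of_nat_eventually:
  assumes mono: "\<And>m n. m \<le> n \<Longrightarrow> f m \<le> f n" and sup: "(SUP m. of_nat (f m) :: ennreal) = of_nat c"
  shows "\<exists>m0. \<forall>m\<ge>m0. f m = (c :: nat)"
proof -
  have le: "f m \<le> c" for m
  proof -
    have "of_nat (f m) \<le> (of_nat c :: ennreal)" unfolding sup[symmetric] by (rule SUP_upper) simp
    then show ?thesis by simp
  qed
  have "c = 0 \<or> (\<exists>m. c \<le> f m)" using of_nat_le_SUP_iff[of c f] sup by simp
  then obtain m0 where "c \<le> f m0" by auto
  then show ?thesis using mono le by (intro exI[of _ m0]) (metis order_antisym order_trans)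
qed

context typed_marked_process
begin

lemma size_filter_seen:
  "(of_nat (size (filter_mset P (seen m \<omega>))) :: ennreal) =
    (\<Sum>n<m. if of_nat n < emeasure (\<Phi> \<omega>) UNIV then \<Sum>i<\<nu> n \<omega>. indicator {z. P (\<tau> z)} (x n \<omega> + y n i \<omega>) else 0)"
proof (induction m)
  case (Suc m)
  have "(of_nat (size (filter_mset P (mset (map (\<lambda>i. \<tau> (g i)) [0..<d])))) :: ennreal) = (\<Sum>i<d. indicator {z. P (\<tau> z)} (g i))" for d and g :: "nat \<Rightarrow> 'a"
    by (induction d) (simp_all add: add.commute)
  note this[of "\<lambda>i. x m \<omega> + y m i \<omega>" "\<nu> m \<omega>", folded types_def]
  then show ?case using Suc by (simp add: seen_def)
qed (simp add: seen_def)

end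

section \<open>Comparison of perturbations\<close>

context typed_marked_process
begin

text \<open>The intensity of the perturbed process: Wald's identity for each realization of the
  points, then Campbell's formula. The predicate \<open>P\<close> expresses membership in
  \<open>A\<close> through types, which is also the source of the measurability of
  \<open>A\<close>.\<close>

lemma nn_integral_SUP_size_filter_seen:
  assumes P: "\<And>z. P (\<tau> z) \<longleftrightarrow> z \<in> A"
  shows "(\<integral>\<^sup>+\<omega>. (SUP m. of_nat (size (filter_mset P (seen m \<omega>)))) \<partial>M) =
    (\<integral>\<^sup>+z. mean_replication N z * emeasure (X z) ((\<lambda>a. a - z) ` A) \<partial>mean_measure M \<Phi>)"
proof -
  have "A = \<tau> -` {b. P b} \<inter> space borel" using P by auto
  then have A [measurable]: "A \<in> sets borel" using measurable_sets[OF measurable_type, of "{b. P b}"] by simp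
  let ?g = "\<lambda>z. mean_replication N z * emeasure (X z) {u. z + u \<in> A}"
  let ?H = "\<lambda>D. of_nat (size (filter_mset P D)) :: ennreal"
  have "(\<integral>\<^sup>+b. ?H {#b#} \<partial>pmf_of_measure (distr (X z) (count_space UNIV) (\<lambda>u. \<tau> (z + u)))) = emeasure (X z) {u. z + u \<in> A}" for z
  proof -
    have [measurable]: "(\<lambda>u. \<tau> (z + u)) \<in> X z \<rightarrow>\<^sub>M count_space UNIV"
      unfolding measurable_cong_sets[OF prob_kernels(4) refl] by measurable
    have "(\<integral>\<^sup>+b. ?H {#b#} \<partial>pmf_of_measure (distr (X z) (count_space UNIV) (\<lambda>u. \<tau> (z + u)))) = (\<integral>\<^sup>+u. ?H {#\<tau> (z + u)#} \<partial>X z)"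
      by (subst measure_pmf_of_measure) (simp_all add: prob_space.prob_space_distr prob_kernels nn_integral_distr)
    also have "\<dots> = (\<integral>\<^sup>+u. indicator {u. z + u \<in> A} u \<partial>X z)"
      by (intro nn_integral_cong) (auto simp: P split: split_indicator)
    also have "\<dots> = emeasure (X z) {u. z + u \<in> A}"
      by (intro nn_integral_indicator) (simp add: prob_kernels sets_translate)
    finally show ?thesis .
  qed
  then have "(\<integral>\<^sup>+D. ?H D \<partial>superposition_pmf (map types_pmf zs)) = (\<Sum>z\<leftarrow>zs. ?g z)" for zs
    using superposition_pmf_additive[of ?H "\<lambda>z. pmf_of_measure (N z)" "\<lambda>z. pmf_of_measure (distr (X z) (count_space UNIV) (\<lambda>u. \<tau> (z + u)))" zs]
    by (simp add: types_pmf_def[abs_def] mean_replication_eq)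
  then have "(\<integral>\<^sup>+\<omega>. (SUP m. ?H (seen m \<omega>)) \<partial>M) = (\<integral>\<^sup>+\<omega>. (SUP m. \<Sum>z\<leftarrow>points \<xi> m (\<Phi> \<omega>). ?g z) \<partial>M)"
    by (subst nn_integral_SUP_seen) simp_all
  also have "\<dots> = (\<integral>\<^sup>+z. ?g z \<partial>mean_measure M \<Phi>)"
    using measurable_translate[OF A]
    by (subst campbell_formula[OF point_process enum]) (simp_all add: sum_list_points suminf_eq_SUP)
  finally show ?thesis unfolding diff_image .
qed

end

text \<open>Replaces the perturbed process by its marks. Local finiteness makes each count a natural
  number, so almost surely the increasing counts of the types seen attain it after finitely many
  points.\<close>

lemma perturbation_process:
  fixes \<Phi> \<Psi> :: "'w \<Rightarrow> 'a::euclidean_space measure"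
  assumes pp: "point_process M \<Phi>" and X: "translation_kernel X" and N: "replication_kernel N"
    and \<Psi>: "perturbation M \<Phi> N X \<Psi>"
    and B: "\<And>r. r < k \<Longrightarrow> B r \<in> sets borel \<and> bounded (B r)"
  obtains \<xi> \<nu> y where "typed_marked_process M \<Phi> N X \<xi> \<nu> y (hit_type k B)"
    and "AE \<omega> in M. \<exists>m0. \<forall>m\<ge>m0. hit_vector k (typed_marked_process.seen \<Phi> \<xi> \<nu> y (hit_type k B) m \<omega>) = count_vector k B (\<Psi> \<omega>)"
proof -
  from \<Psi> obtain \<xi> \<nu> y where \<xi>: "point_enumeration \<xi>" and marks: "perturbation_marks M \<Phi> N X \<xi> \<nu> y"
    and eq: "AE \<omega> in M. \<forall>B\<in>sets borel. emeasure (\<Psi> \<omega>) B =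
             (\<Sum>n. if of_nat n < emeasure (\<Phi> \<omega>) UNIV
                   then \<Sum>i<\<nu> n \<omega>. indicator B (\<xi> n (\<Phi> \<omega>) + y n i \<omega>) else 0)"
    and pp\<Psi>: "point_process M \<Psi>"
    unfolding perturbation_def by blast
  have "typed_marked_process M \<Phi> N X \<xi> \<nu> y (hit_type k B)"
    using pp X N \<xi> marks measurable_hit_type[of k B] B
    by (auto simp: typed_marked_process_def typed_marked_process_axioms_def marked_process_def marked_process_axioms_def
        point_process_def translation_kernel_def replication_kernel_def)
  then interpret typed_marked_process M \<Phi> N X \<xi> \<nu> y "hit_type k B" .
  have "AE \<omega> in M. \<exists>m0. \<forall>m\<ge>m0. hit_vector k (seen m \<omega>) = count_vector k B (\<Psi> \<omega>)"
    using eq AE_space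
  proof eventually_elim
    fix \<omega> assume eq: "\<forall>B\<in>sets borel. emeasure (\<Psi> \<omega>) B =
             (\<Sum>n. if of_nat n < emeasure (\<Phi> \<omega>) UNIV
                   then \<Sum>i<\<nu> n \<omega>. indicator B (\<xi> n (\<Phi> \<omega>) + y n i \<omega>) else 0)" and \<omega>: "\<omega> \<in> space M"
    have "\<Psi> \<omega> \<in> space counting_measures"
      using pp\<Psi> \<omega> by (auto simp: point_process_def intro: measurable_space)
    then have lf: "locally_finite_counting (\<Psi> \<omega>)" by (simp add: space_counting_measures)
    have "\<exists>m0. \<forall>m\<ge>m0. real (size (filter_mset (\<lambda>b. b ! r) (seen m \<omega>))) = measure (\<Psi> \<omega>) (B r)" if r: "r < k" for r
    proof -
      obtain c where c: "emeasure (\<Psi> \<omega>) (B r) = of_nat c"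
        using lf B[OF r] by (auto simp: locally_finite_counting_def elim!: Nats_cases)
      have hit: "{z. hit_type k B z ! r} = B r" using r by (auto simp: hit_type_def)
      have "(SUP m. of_nat (size (filter_mset (\<lambda>b. b ! r) (seen m \<omega>)))) = emeasure (\<Psi> \<omega>) (B r)"
        unfolding size_filter_seen hit eq[rule_format, OF conjunct1[OF B[OF r]]] suminf_eq_SUP ..
      then have "\<exists>m0. \<forall>m\<ge>m0. size (filter_mset (\<lambda>b. b ! r) (seen m \<omega>)) = c"
        unfolding c by (intro SUP_of_nat_eventually) (auto intro!: size_mset_mono multiset_filter_mono mset_seen_mono)
      then show ?thesis using c by (simp add: measure_def ennreal_of_nat_eq_real_of_nat)
    qed
    then obtain m0 where m0: "\<And>r m. r < k \<Longrightarrow> m0 r \<le> m \<Longrightarrow> real (size (filter_mset (\<lambda>b. b ! r) (seen m \<omega>))) = measure (\<Psi> \<omega>) (B r)"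
      by metis
    \<comment> \<open>The sum of the \<open>k\<close> thresholds dominates each of them.\<close>
    have "hit_vector k (seen m \<omega>) = count_vector k B (\<Psi> \<omega>)" if "(\<Sum>r<k. m0 r) \<le> m" for m
    proof -
      have "m0 r \<le> m" if "r < k" for r
        using member_le_sum[of r "{..<k}" m0] that \<open>(\<Sum>r<k. m0 r) \<le> m\<close> by auto
      then show ?thesis using m0 by (auto simp: hit_vector_def count_vector_def intro!: restrict_ext)
    qed
    then show "\<exists>m0. \<forall>m\<ge>m0. hit_vector k (seen m \<omega>) = count_vector k B (\<Psi> \<omega>)" by blast
  qed
  then show ?thesis using that typed_marked_process_axioms by blast
qed

text \<open>Along the truncations \<open>H\<close> is nondecreasing, so its eventual value is its
  supremum.\<close>

lemma (in typed_marked_process) nn_integral_count_vector: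
  fixes H :: "'b multiset \<Rightarrow> ennreal"
  assumes H: "\<And>A D. H A \<le> H (A + D)"
    and ev: "AE \<omega> in M. \<exists>m0. \<forall>m\<ge>m0. H (seen m \<omega>) = F \<omega>"
  shows "(\<integral>\<^sup>+\<omega>. F \<omega> \<partial>M) = (\<integral>\<^sup>+\<omega>. (SUP m. H (seen m \<omega>)) \<partial>M)"
proof (rule nn_integral_cong_AE, use ev in eventually_elim)
  fix \<omega> assume "\<exists>m0. \<forall>m\<ge>m0. H (seen m \<omega>) = F \<omega>"
  then obtain m0 where m0: "\<And>m. m0 \<le> m \<Longrightarrow> H (seen m \<omega>) = F \<omega>" by blast
  show "F \<omega> = (SUP m. H (seen m \<omega>))"
  proof (rule antisym)
    show "F \<omega> \<le> (SUP m. H (seen m \<omega>))" using m0[of m0] by (intro SUP_upper2[of m0]) auto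
    show "(SUP m. H (seen m \<omega>)) \<le> F \<omega>"
    proof (rule SUP_least)
      fix m
      have "H (seen m \<omega>) \<le> H (seen (max m m0) \<omega>)"
        using H[of "seen m \<omega>" "seen (max m m0) \<omega> - seen m \<omega>"] mset_seen_mono[of m "max m m0" \<omega>] by simp
      then show "H (seen m \<omega>) \<le> F \<omega>" using m0 by simp
    qed
  qed
qed

text \<open>A single set is enough here, so the types are taken with \<open>k = 1\<close> and a
  constant family, and the count is the coordinate 0.\<close>

lemma perturbation_count_moments:
  fixes \<Phi> \<Psi> :: "'w \<Rightarrow> 'a::euclidean_space measure"
  assumes pp: "point_process M \<Phi>" and X: "translation_kernel X" and N: "replication_kernel N"
    and \<Psi>: "perturbation M \<Phi> N X \<Psi>" and B: "B \<in> sets borel" "bounded B"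
  shows "(\<integral>\<^sup>+\<omega>. ennreal (measure (\<Psi> \<omega>) B) \<partial>M) =
    (\<integral>\<^sup>+z. mean_replication N z * emeasure (X z) ((\<lambda>a. a - z) ` B) \<partial>mean_measure M \<Phi>)"
proof -
  obtain \<xi> \<nu> y where tm: "typed_marked_process M \<Phi> N X \<xi> \<nu> y (hit_type 1 (\<lambda>_. B))"
    and ev: "AE \<omega> in M. \<exists>m0. \<forall>m\<ge>m0. hit_vector 1 (typed_marked_process.seen \<Phi> \<xi> \<nu> y (hit_type 1 (\<lambda>_. B)) m \<omega>)
      = count_vector 1 (\<lambda>_. B) (\<Psi> \<omega>)"
    by (rule perturbation_process[OF pp X N \<Psi>, of 1 "\<lambda>_. B"]) (use B in auto)
  interpret typed_marked_process M \<Phi> N X \<xi> \<nu> y "hit_type 1 (\<lambda>_. B)" by fact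
  let ?H = "\<lambda>A. of_nat (size (filter_mset (\<lambda>b. b ! 0) A)) :: ennreal"
  have "AE \<omega> in M. \<exists>m0. \<forall>m\<ge>m0. ?H (seen m \<omega>) = ennreal (measure (\<Psi> \<omega>) B)"
    using ev
  proof eventually_elim
    fix \<omega> assume "\<exists>m0. \<forall>m\<ge>m0. hit_vector 1 (seen m \<omega>) = count_vector 1 (\<lambda>_. B) (\<Psi> \<omega>)"
    then obtain m0 where m0: "\<And>m. m0 \<le> m \<Longrightarrow> hit_vector 1 (seen m \<omega>) = count_vector 1 (\<lambda>_. B) (\<Psi> \<omega>)" by blast
    have "?H (seen m \<omega>) = ennreal (measure (\<Psi> \<omega>) B)" if "m0 \<le> m" for m
      using fun_cong[OF m0[OF that], of 0] by (simp add: hit_vector_def count_vector_def ennreal_of_nat_eq_real_of_nat)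
    then show "\<exists>m0. \<forall>m\<ge>m0. ?H (seen m \<omega>) = ennreal (measure (\<Psi> \<omega>) B)" by blast
  qed
  then have "(\<integral>\<^sup>+\<omega>. ennreal (measure (\<Psi> \<omega>) B) \<partial>M) = (\<integral>\<^sup>+\<omega>. (SUP m. ?H (seen m \<omega>)) \<partial>M)"
    by (intro nn_integral_count_vector) simp_all
  also have "\<dots> = (\<integral>\<^sup>+z. mean_replication N z * emeasure (X z) ((\<lambda>a. a - z) ` B) \<partial>mean_measure M \<Phi>)"
    by (rule nn_integral_SUP_size_filter_seen) (simp add: hit_type_def)
  finally show ?thesis .
qed

theorem proposition6p1:
  fixes M :: "'w measure"
    and \<Phi> \<Psi>\<^sub>1 \<Psi>\<^sub>2 :: "'w \<Rightarrow> (real ^ 'd) measure"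
    and X :: "real ^ 'd \<Rightarrow> (real ^ 'd) measure"
    and N\<^sub>1 N\<^sub>2 :: "real ^ 'd \<Rightarrow> nat measure"
  assumes "point_process M \<Phi>"
    and "radon_measure (mean_measure M \<Phi>)"
    and "translation_kernel X"
    and "replication_kernel N\<^sub>1" and "replication_kernel N\<^sub>2"
    and "perturbation M \<Phi> N\<^sub>1 X \<Psi>\<^sub>1"
    and "perturbation M \<Phi> N\<^sub>2 X \<Psi>\<^sub>2"
    and "\<And>A. A \<in> sets borel \<Longrightarrow> bounded A \<Longrightarrow>
           (\<integral>\<^sup>+x. mean_replication N\<^sub>1 x * emeasure (X x) ((\<lambda>a. a - x) ` A) \<partial>mean_measure M \<Phi>) < \<infinity>"
    and "\<And>A. A \<in> sets borel \<Longrightarrow> bounded A \<Longrightarrow>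
           (\<integral>\<^sup>+x. mean_replication N\<^sub>2 x * emeasure (X x) ((\<lambda>a. a - x) ` A) \<partial>mean_measure M \<Phi>) < \<infinity>"
    and "AE x in mean_measure M \<Phi>. cx_le (distr (N\<^sub>1 x) borel real) (distr (N\<^sub>2 x) borel real)"
  shows "dcx_le M \<Psi>\<^sub>1 M \<Psi>\<^sub>2"
  unfolding dcx_le_def
proof (intro allI impI, elim conjE)
  fix k :: nat and B :: "nat \<Rightarrow> (real ^ 'd) set" and f :: "(nat \<Rightarrow> real) \<Rightarrow> real"
  assume B: "\<forall>i<k. B i \<in> sets borel \<and> bounded (B i)" and f: "dcx k f"
    and int1: "integrable M (\<lambda>\<omega>. f (count_vector k B (\<Psi>\<^sub>1 \<omega>)))"
    and int2: "integrable M (\<lambda>\<omega>. f (count_vector k B (\<Psi>\<^sub>2 \<omega>)))"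
  let ?\<tau> = "hit_type k B"
  let ?h = "dcx_remainder k f"
  obtain \<xi>\<^sub>1 \<nu>\<^sub>1 y\<^sub>1 where tm1: "typed_marked_process M \<Phi> N\<^sub>1 X \<xi>\<^sub>1 \<nu>\<^sub>1 y\<^sub>1 ?\<tau>"
    and ev1: "AE \<omega> in M. \<exists>m0. \<forall>m\<ge>m0. hit_vector k (typed_marked_process.seen \<Phi> \<xi>\<^sub>1 \<nu>\<^sub>1 y\<^sub>1 ?\<tau> m \<omega>) = count_vector k B (\<Psi>\<^sub>1 \<omega>)"
    by (rule perturbation_process[OF assms(1,3,4,6), of k B]) (use B in auto)
  obtain \<xi>\<^sub>2 \<nu>\<^sub>2 y\<^sub>2 where tm2: "typed_marked_process M \<Phi> N\<^sub>2 X \<xi>\<^sub>2 \<nu>\<^sub>2 y\<^sub>2 ?\<tau>"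
    and ev2: "AE \<omega> in M. \<exists>m0. \<forall>m\<ge>m0. hit_vector k (typed_marked_process.seen \<Phi> \<xi>\<^sub>2 \<nu>\<^sub>2 y\<^sub>2 ?\<tau> m \<omega>) = count_vector k B (\<Psi>\<^sub>2 \<omega>)"
    by (rule perturbation_process[OF assms(1,3,5,7), of k B]) (use B in auto)
  interpret P: typed_marked_process M \<Phi> N\<^sub>1 X \<xi>\<^sub>1 \<nu>\<^sub>1 y\<^sub>1 ?\<tau> by fact
  interpret Q: typed_marked_process M \<Phi> N\<^sub>2 X \<xi>\<^sub>2 \<nu>\<^sub>2 y\<^sub>2 ?\<tau> by fact

  have fin1: "AE z in mean_measure M \<Phi>. mean_replication N\<^sub>1 z < \<infinity>"
    by (rule P.AE_mean_replication_finite) (rule assms(8))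
  have fin2: "AE z in mean_measure M \<Phi>. mean_replication N\<^sub>2 z < \<infinity>"
    by (rule Q.AE_mean_replication_finite) (rule assms(9))
  let ?p = "\<lambda>z. pmf_of_measure (N\<^sub>1 z)" and ?q = "\<lambda>z. pmf_of_measure (N\<^sub>2 z)"
  have "AE z in mean_measure M \<Phi>. (\<forall>j. (\<integral>\<^sup>+d. of_nat (d - j) \<partial>?p z) \<le> (\<integral>\<^sup>+d. of_nat (d - j) \<partial>?q z))
      \<and> mean_replication N\<^sub>1 z = mean_replication N\<^sub>2 z"
    using assms(10) fin1 fin2
  proof eventually_elim
    fix z assume "cx_le (distr (N\<^sub>1 z) borel real) (distr (N\<^sub>2 z) borel real)"
      "mean_replication N\<^sub>1 z < \<infinity>" "mean_replication N\<^sub>2 z < \<infinity>"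
    then show "(\<forall>j. (\<integral>\<^sup>+d. of_nat (d - j) \<partial>?p z) \<le> (\<integral>\<^sup>+d. of_nat (d - j) \<partial>?q z))
      \<and> mean_replication N\<^sub>1 z = mean_replication N\<^sub>2 z"
      using cx_le_pmf[of "?p z" "?q z"]
      by (simp add: P.mean_replication_eq Q.mean_replication_eq P.measure_pmf_replicas Q.measure_pmf_replicas)
  qed
  then have le: "AE z in mean_measure M \<Phi>. \<forall>j. (\<integral>\<^sup>+d. of_nat (d - j) \<partial>?p z) \<le> (\<integral>\<^sup>+d. of_nat (d - j) \<partial>?q z)"
    and mean_eq: "AE z in mean_measure M \<Phi>. mean_replication N\<^sub>1 z = mean_replication N\<^sub>2 z"
    by (auto elim: AE_mp)

  have h_le: "(\<integral>\<^sup>+\<omega>. ennreal (?h (count_vector k B (\<Psi>\<^sub>1 \<omega>))) \<partial>M) \<le> (\<integral>\<^sup>+\<omega>. ennreal (?h (count_vector k B (\<Psi>\<^sub>2 \<omega>))) \<partial>M)"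
  proof -
    let ?H = "\<lambda>A. ennreal (?h (hit_vector k A))"
    have H: "?H A \<le> ?H (A + D)" for A D
      using dcx_remainder_hit_vector(2)[OF f] by (rule ennreal_leI)
    have "AE \<omega> in M. \<exists>m0. \<forall>m\<ge>m0. ?H (P.seen m \<omega>) = ennreal (?h (count_vector k B (\<Psi>\<^sub>1 \<omega>)))"
      using ev1 by eventually_elim metis
    then have "(\<integral>\<^sup>+\<omega>. ennreal (?h (count_vector k B (\<Psi>\<^sub>1 \<omega>))) \<partial>M) = (\<integral>\<^sup>+\<omega>. (SUP m. ?H (P.seen m \<omega>)) \<partial>M)"
      using H by (intro P.nn_integral_count_vector)
    also have "\<dots> \<le> (\<integral>\<^sup>+\<omega>. (SUP m. ?H (Q.seen m \<omega>)) \<partial>M)"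
    proof (rule nn_integral_SUP_seen_mono[OF tm1 tm2, where H = ?H, OF H])
      show "AE \<omega> in M. \<forall>m. (\<integral>\<^sup>+A. ?H A \<partial>superposition_pmf (map P.types_pmf (points \<xi>\<^sub>1 m (\<Phi> \<omega>))))
        \<le> (\<integral>\<^sup>+A. ?H A \<partial>superposition_pmf (map Q.types_pmf (points \<xi>\<^sub>1 m (\<Phi> \<omega>))))"
        using P.AE_points[OF le]
      proof eventually_elim
        fix \<omega> assume "\<forall>m. \<forall>z\<in>set (points \<xi>\<^sub>1 m (\<Phi> \<omega>)). \<forall>j. (\<integral>\<^sup>+d. of_nat (d - j) \<partial>?p z) \<le> (\<integral>\<^sup>+d. of_nat (d - j) \<partial>?q z)"
        then show "\<forall>m. (\<integral>\<^sup>+A. ?H A \<partial>superposition_pmf (map P.types_pmf (points \<xi>\<^sub>1 m (\<Phi> \<omega>))))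
            \<le> (\<integral>\<^sup>+A. ?H A \<partial>superposition_pmf (map Q.types_pmf (points \<xi>\<^sub>1 m (\<Phi> \<omega>))))"
          unfolding P.types_pmf_def[abs_def] Q.types_pmf_def[abs_def]
          by (intro allI superposition_pmf_mono msupermodular_dcx_remainder f) blast
      qed
    qed
    also have "AE \<omega> in M. \<exists>m0. \<forall>m\<ge>m0. ?H (Q.seen m \<omega>) = ennreal (?h (count_vector k B (\<Psi>\<^sub>2 \<omega>)))"
      using ev2 by eventually_elim metis
    then have "(\<integral>\<^sup>+\<omega>. (SUP m. ?H (Q.seen m \<omega>)) \<partial>M) = (\<integral>\<^sup>+\<omega>. ennreal (?h (count_vector k B (\<Psi>\<^sub>2 \<omega>))) \<partial>M)"
      using H by (intro Q.nn_integral_count_vector[symmetric])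
    finally show ?thesis .
  qed

  \<comment> \<open>Stated for a generic perturbation, since it serves both. The replication kernel
    enters the expected count only through its mean, so almost everywhere equal means give equal
    expectations.\<close>
  have decomp: "integrable M (\<lambda>\<omega>. measure (\<Psi> \<omega>) (B r)) \<and>
      ennreal (\<integral>\<omega>. measure (\<Psi> \<omega>) (B r) \<partial>M) =
        (\<integral>\<^sup>+z. mean_replication N z * emeasure (X z) ((\<lambda>a. a - z) ` B r) \<partial>mean_measure M \<Phi>)"
    if "r < k" "replication_kernel N" "perturbation M \<Phi> N X \<Psi>"
      "\<And>A. A \<in> sets borel \<Longrightarrow> bounded A \<Longrightarrow>
           (\<integral>\<^sup>+x. mean_replication N x * emeasure (X x) ((\<lambda>a. a - x) ` A) \<partial>mean_measure M \<Phi>) < \<infinity>"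
    for r N \<Psi>
  proof -
    have "\<Psi> \<in> M \<rightarrow>\<^sub>M counting_measures" using that(3) by (simp add: perturbation_def point_process_def)
    then have m: "(\<lambda>\<omega>. measure (\<Psi> \<omega>) (B r)) \<in> borel_measurable M"
      unfolding measure_def using measurable_emeasure_counting_measures[of "B r"] B that(1)
      by (intro borel_measurable_enn2real) (auto intro: measurable_compose)
    have nn: "(\<integral>\<^sup>+\<omega>. ennreal (measure (\<Psi> \<omega>) (B r)) \<partial>M) =
        (\<integral>\<^sup>+z. mean_replication N z * emeasure (X z) ((\<lambda>a. a - z) ` B r) \<partial>mean_measure M \<Phi>)"
      using B that(1) by (intro perturbation_count_moments[OF assms(1,3) that(2,3)]) auto
    have int: "integrable M (\<lambda>\<omega>. measure (\<Psi> \<omega>) (B r))"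
      using m nn that(4)[of "B r"] B that(1) by (intro integrableI_bounded) auto
    show ?thesis using int nn nn_integral_eq_integral[OF int] by simp
  qed
  note d1 = decomp[OF _ assms(4,6,8)] and d2 = decomp[OF _ assms(5,7,9)]
  have lin: "(\<integral>\<omega>. measure (\<Psi>\<^sub>1 \<omega>) (B r) \<partial>M) = (\<integral>\<omega>. measure (\<Psi>\<^sub>2 \<omega>) (B r) \<partial>M)" if "r < k" for r
  proof -
    have "(\<integral>\<^sup>+z. mean_replication N\<^sub>1 z * emeasure (X z) ((\<lambda>a. a - z) ` B r) \<partial>mean_measure M \<Phi>)
      = (\<integral>\<^sup>+z. mean_replication N\<^sub>2 z * emeasure (X z) ((\<lambda>a. a - z) ` B r) \<partial>mean_measure M \<Phi>)"
      by (rule nn_integral_cong_AE, use mean_eq in eventually_elim) simp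
    then have "ennreal (\<integral>\<omega>. measure (\<Psi>\<^sub>1 \<omega>) (B r) \<partial>M) = ennreal (\<integral>\<omega>. measure (\<Psi>\<^sub>2 \<omega>) (B r) \<partial>M)"
      using d1[OF that] d2[OF that] by simp
    then show ?thesis by (subst (asm) ennreal_inj) (auto intro!: integral_nonneg)
  qed
  \<comment> \<open>The affine part is integrable by \<open>decomp\<close>, so integrability of
    \<open>f\<close> passes to the remainder and the expectation may be split.\<close>
  have integral_f: "integrable M (\<lambda>\<omega>. ?h (count_vector k B (\<Psi> \<omega>))) \<and>
      (\<integral>\<omega>. f (count_vector k B (\<Psi> \<omega>)) \<partial>M) = f (\<lambda>r\<in>{..<k}. 0) +
        (\<Sum>r<k. dcx_slope k f r * (\<integral>\<omega>. measure (\<Psi> \<omega>) (B r) \<partial>M)) + (\<integral>\<omega>. ?h (count_vector k B (\<Psi> \<omega>)) \<partial>M)"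
    if f: "integrable M (\<lambda>\<omega>. f (count_vector k B (\<Psi> \<omega>)))" and m: "\<And>r. r < k \<Longrightarrow> integrable M (\<lambda>\<omega>. measure (\<Psi> \<omega>) (B r))" for \<Psi>
  proof -
    have eq: "?h (count_vector k B (\<Psi> \<omega>)) = f (count_vector k B (\<Psi> \<omega>)) - f (\<lambda>r\<in>{..<k}. 0)
        - (\<Sum>r<k. dcx_slope k f r * measure (\<Psi> \<omega>) (B r))" for \<omega>
      unfolding dcx_remainder_def by (simp add: count_vector_def)
    have sum: "integrable M (\<lambda>\<omega>. \<Sum>r<k. dcx_slope k f r * measure (\<Psi> \<omega>) (B r))"
      by (intro Bochner_Integration.integrable_sum integrable_mult_right) (simp add: m)
    have "(\<integral>\<omega>. (\<Sum>r<k. dcx_slope k f r * measure (\<Psi> \<omega>) (B r)) \<partial>M)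
        = (\<Sum>r<k. dcx_slope k f r * (\<integral>\<omega>. measure (\<Psi> \<omega>) (B r) \<partial>M))"
      by (subst Bochner_Integration.integral_sum) (simp_all add: m)
    then show ?thesis unfolding eq using f sum by (simp add: P.prob_space)
  qed
  \<comment> \<open>The remainder is known to be nonnegative on lattice vectors only; that the
    counts almost surely form one is read off from the eventual equality with
    \<open>hit_vector\<close>.\<close>
  have nonneg: "AE \<omega> in M. 0 \<le> ?h (count_vector k B (\<Psi> \<omega>))"
    if "AE \<omega> in M. \<exists>m0. \<forall>m\<ge>m0. hit_vector k (s m \<omega>) = count_vector k B (\<Psi> \<omega>)" for \<Psi> and s :: "nat \<Rightarrow> _"
    using that by eventually_elim (metis dcx_remainder_hit_vector(3)[OF f] order_refl)
  have i1: "integrable M (\<lambda>\<omega>. ?h (count_vector k B (\<Psi>\<^sub>1 \<omega>)))" and i2: "integrable M (\<lambda>\<omega>. ?h (count_vector k B (\<Psi>\<^sub>2 \<omega>)))"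
    using integral_f[OF int1] integral_f[OF int2] d1 d2 by auto
  have "(\<integral>\<omega>. ?h (count_vector k B (\<Psi>\<^sub>1 \<omega>)) \<partial>M) \<le> (\<integral>\<omega>. ?h (count_vector k B (\<Psi>\<^sub>2 \<omega>)) \<partial>M)"
    using h_le unfolding nn_integral_eq_integral[OF i1 nonneg[OF ev1]] nn_integral_eq_integral[OF i2 nonneg[OF ev2]]
    by (subst (asm) ennreal_le_iff) (auto intro!: integral_nonneg_AE nonneg[OF ev2])
  then show "(\<integral>\<omega>. f (count_vector k B (\<Psi>\<^sub>1 \<omega>)) \<partial>M) \<le> (\<integral>\<omega>. f (count_vector k B (\<Psi>\<^sub>2 \<omega>)) \<partial>M)"
    using integral_f[OF int1] integral_f[OF int2] d1 d2 lin by simp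
qed

end
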